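(* Let $T$ be a tree and let $k\in\{1,2,3,4,5\}$. Then the $k$-apex of $T$ is common.
   Context: All graphs are finite and simple. The $k$-apex of a graph $G$ is the graph obtained from $G$ by adding $k$ new vertices, each adjacent to every vertex of $G$, where the $k$ new vertices form an independent set. A graphon is a symmetric measurable function $W:[0,1]^2\to[0,1]$. For a graph $H$, the homomorphism density is $t(H,W)=\int_{[0,1]^{V(H)}}\prod_{uv\in E(H)}W(x_u,x_v)\,dx_{V(H)}$, and the monochromatic density is $m(H,W)=t(H,W)+t(H,1-W)$, where $(1-W)(x,y)=1-W(x,y)$. A graph $H$ with $e(H)$ edges is common if $m(H,W)\ge 2^{1-e(H)}$ for every graphon $W$ (equivalently, the minimum number of monochromatic copies of $H$ over all 2-edge-colorings of $K_n$ is asymptotically at least that in the uniformly random 2-edge-coloring). *)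

theory Defs
  imports "HOL-Analysis.Analysis"
begin

record 'a graph =
  verts :: "'a set"
  edges :: "'a set set"

definition simple_graph :: "'a graph \<Rightarrow> bool" where
  "simple_graph G \<longleftrightarrow>
     finite (verts G) \<and> edges G \<subseteq> {e. e \<subseteq> verts G \<and> card e = 2}"

definition graph_connected :: "'a graph \<Rightarrow> bool" where
  "graph_connected G \<longleftrightarrow> verts G \<noteq> {} \<and>
     (\<forall>u\<in>verts G. \<forall>v\<in>verts G. (u, v) \<in> {(a, b). {a, b} \<in> edges G}\<^sup>*)"

definition graph_cycle :: "'a graph \<Rightarrow> 'a list \<Rightarrow> bool" where
  "graph_cycle G c \<longleftrightarrow> length c \<ge> 3 \<and> distinct c \<and>
     (\<forall>i<length c. {c ! i, c ! (Suc i mod length c)} \<in> edges G)"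

definition tree :: "'a graph \<Rightarrow> bool" where
  "tree G \<longleftrightarrow> simple_graph G \<and> graph_connected G \<and> (\<nexists>c. graph_cycle G c)"

definition apex :: "nat \<Rightarrow> 'a graph \<Rightarrow> ('a + nat) graph" where
  "apex k G =
     \<lparr>verts = verts G <+> {..<k},
      edges = (\<lambda>e. Inl ` e) ` edges G \<union> {{Inl v, Inr i} |v i. v \<in> verts G \<and> i < k}\<rparr>"

lemma simple_graph_apex:
  assumes "simple_graph G"
  shows "simple_graph (apex k G)"
  using assms by (auto simp: simple_graph_def apex_def card_image)

(* Only the values of W on the unit square matter. Measurability is meant in the sense of
   Lebesgue, so that all Borel measurable W are included as well. *)
definition graphon :: "(real \<Rightarrow> real \<Rightarrow> real) \<Rightarrow> bool" where
  "graphon W \<longleftrightarrow>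
     (\<lambda>(x, y). W x y) \<in> borel_measurable (lebesgue_on ({0..1} \<times> {0..1})) \<and>
     (\<forall>x\<in>{0..1}. \<forall>y\<in>{0..1}. W x y = W y x \<and> W x y \<in> {0..1})"

(* An arbitrary orientation of the edge e. By symmetry, the choice does not affect the value
   of a graphon on the edge, see edge_ends_symmetric below. *)
definition edge_ends :: "'a set \<Rightarrow> 'a \<times> 'a" where
  "edge_ends e = (SOME (u, v). e = {u, v})"

lemma edge_ends_symmetric:
  assumes "f u v = f v u"
  shows "(case edge_ends {u, v} of (a, b) \<Rightarrow> f a b) = f u v"
proof -
  have "case edge_ends {u, v} of (a, b) \<Rightarrow> {u, v} = {a, b}"
    unfolding edge_ends_def by (rule someI[where x = "(u, v)"]) simp
  with assms show ?thesis
    by (auto simp: doubleton_eq_iff split: prod.splits)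
qed

(* The product measure is completed because the integrand is in general not measurable with
   respect to the product of the Borel sigma-algebras if W is only Lebesgue measurable. *)
definition hom_density :: "'a graph \<Rightarrow> (real \<Rightarrow> real \<Rightarrow> real) \<Rightarrow> real" where
  "hom_density H W =
     (\<integral>x. (\<Prod>e\<in>edges H. case edge_ends e of (u, v) \<Rightarrow> W (x u) (x v))
       \<partial>completion (\<Pi>\<^sub>M v\<in>verts H. restrict_space lborel {0..1}))"

definition mono_density :: "'a graph \<Rightarrow> (real \<Rightarrow> real \<Rightarrow> real) \<Rightarrow> real" where
  "mono_density H W = hom_density H W + hom_density H (\<lambda>x y. 1 - W x y)"

definition common :: "'a graph \<Rightarrow> bool" where
  "common H \<longleftrightarrow>
     (\<forall>W. graphon W \<longrightarrow> mono_density H W \<ge> 2 powr (1 - real (card (edges H))))"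

end

theory Submission
  imports Defs "HOL-Probability.Infinite_Product_Measure"
begin

text \<open>
  Write $m$ for the number of edges of $T$ and $\lambda = 2^{-(k+1)}$. Fixing the images of the apex
  vertices turns the density of the $k$-apex into a density of $T$ in $W$ with vertex weight
  $f(x) = \prod_i W(x, y_i)$. By the entropy argument (Jensen for the stationary distribution of the
  random walk on the weighted kernel) the latter is at least $E^m / F^{m-1}$, with $F = \int f$ and
  $E = \int\!\int f(x) W(x,y) f(y)$, hence at least $\lambda^m (F + m (E/\lambda - F))$ by Bernoulli. This
  bound is linear in $(E, F)$, so it survives integration over the $y_i$ and summation over the two
  colours: the monochromatic density is at least $\lambda^m (B + m (A/\lambda - B))$ with
  $A = m(K_{1,1,k}, W)$ and $B = m(K_{1,k}, W) \ge 2^{1-k}$.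

  It remains to see that $A \ge \lambda B$. Let $u = \int (2 d(x) - 1)^2$ for the degree function $d$.
  Bernoulli and Goodman's formula give $A \ge m(K_3, W)^k = 4^{-k} (1 + 3u)^k \ge 4^{-k} (1 + 3ku)$,
  while $\lambda B \le 4^{-k} (1 + (2^{k-1} - 1) u)$; finally $2^{k-1} - 1 \le 3k$ holds exactly for $k \le 5$.
\<close>

subsection \<open>Trees as leafwise extensions\<close>

text \<open>Trees are needed as an induction principle that attaches one leaf at a time. Vertex and
  edge sets are separate arguments, so that the predicate also applies to induced parts of a
  graph.\<close>

inductive leafwise :: "'a set \<Rightarrow> 'a set set \<Rightarrow> bool" where
  single: "leafwise {v} {}"
| leaf: "leafwise V E \<Longrightarrow> v \<in> V \<Longrightarrow> w \<notin> V \<Longrightarrow> leafwise (insert w V) (insert {v, w} E)"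

lemma leafwise_finite: "leafwise V E \<Longrightarrow> finite V \<and> finite E \<and> V \<noteq> {}"
  by (induction rule: leafwise.induct) auto

lemma leafwise_edge:
  assumes "leafwise V E" "e \<in> E"
  obtains a b where "e = {a, b}" "a \<in> V" "b \<in> V" "a \<noteq> b"
proof -
  have "\<forall>e\<in>E. \<exists>a b. e = {a, b} \<and> a \<in> V \<and> b \<in> V \<and> a \<noteq> b"
    using assms(1) by (induction rule: leafwise.induct) (auto, blast+)
  with assms(2) that show ?thesis by blast
qed

lemma leafwise_card: "leafwise V E \<Longrightarrow> card V = Suc (card E)"
proof (induction rule: leafwise.induct)
  case (leaf V E v w)
  have "{v, w} \<notin> E"
    using leafwise_edge[OF leaf.hyps(1)] leaf.hyps(3) by (metis insertCI insertE singletonD)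
  then show ?case
    using leaf leafwise_finite[OF leaf.hyps(1)] by simp
qed simp

text \<open>Transports the structure to the copy of the tree inside its apex, where \<open>h\<close>
  is \<open>Inl\<close>.\<close>

lemma leafwise_image:
  assumes "inj h"
  shows "leafwise V E \<Longrightarrow> leafwise (h ` V) ((`) h ` E)"
proof (induction rule: leafwise.induct)
  case (leaf V E v w)
  then have "leafwise (insert (h w) (h ` V)) (insert {h v, h w} ((`) h ` E))"
    using assms by (intro leafwise.leaf) (auto dest: injD)
  then show ?case by simp
qed (auto intro: leafwise.single)

section \<open>Paths, cycles and growing a tree leaf by leaf\<close>

definition is_path :: "'a set set \<Rightarrow> 'a list \<Rightarrow> bool" where
  "is_path E p \<longleftrightarrow> distinct p \<and> (\<forall>i. Suc i < length p \<longrightarrow> {p ! i, p ! Suc i} \<in> E)"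

lemma is_path_rev: "is_path E p \<Longrightarrow> is_path E (rev p)"
proof -
  assume p: "is_path E p"
  have "{rev p ! i, rev p ! Suc i} \<in> E" if "Suc i < length p" for i
  proof -
    let ?j = "length p - Suc (Suc i)"
    have "{p ! ?j, p ! Suc ?j} \<in> E" using p that by (simp add: is_path_def)
    moreover have "Suc ?j = length p - Suc i" using that by simp
    ultimately show ?thesis using that by (simp add: rev_nth insert_commute)
  qed
  with p show ?thesis by (simp add: is_path_def)
qed

lemma is_path_mono: "is_path E p \<Longrightarrow> E \<subseteq> F \<Longrightarrow> is_path F p"
  by (auto simp: is_path_def)

lemma is_path_Cons:
  assumes "is_path E p" "p \<noteq> []" "{w, hd p} \<in> E" "w \<notin> set p"
  shows "is_path E (w # p)"
  using assms by (auto simp: is_path_def nth_Cons hd_conv_nth split: nat.splits)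

text \<open>A path from the new leaf \<open>w\<close> prepends \<open>w\<close> to a path from its
  neighbour \<open>v\<close>; a path ending in \<open>w\<close> is such a path reversed.\<close>

lemma leafwise_path:
  assumes "leafwise V E" "a \<in> V" "b \<in> V"
  shows "\<exists>p. p \<noteq> [] \<and> is_path E p \<and> set p \<subseteq> V \<and> hd p = a \<and> last p = b"
  using assms
proof (induction arbitrary: a b rule: leafwise.induct)
  case (single v)
  then show ?case by (intro exI[of _ "[v]"]) (auto simp: is_path_def)
next
  case (leaf V E v w)
  have new: "\<exists>p. p \<noteq> [] \<and> is_path (insert {v, w} E) p \<and> set p \<subseteq> insert w V \<and> hd p = w \<and> last p = b"
    if b: "b \<in> V" for b
  proof -
    obtain p where p: "p \<noteq> []" "is_path E p" "set p \<subseteq> V" "hd p = v" "last p = b"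
      using leaf.IH[OF leaf.hyps(2) b] by blast
    have "is_path (insert {v, w} E) (w # p)"
      using p leaf.hyps by (intro is_path_Cons) (auto simp: insert_commute intro: is_path_mono)
    with p show ?thesis by (intro exI[of _ "w # p"]) auto
  qed
  consider "a = w" "b = w" | "a = w" "b \<in> V" | "a \<in> V" "b = w" | "a \<in> V" "b \<in> V"
    using leaf.prems by blast
  then show ?case
  proof cases
    case 1
    then show ?thesis by (intro exI[of _ "[w]"]) (auto simp: is_path_def)
  next
    case 2
    then show ?thesis using new by simp
  next
    case 3
    then obtain p where p: "p \<noteq> []" "is_path (insert {v, w} E) p" "set p \<subseteq> insert w V"
      "hd p = w" "last p = a" using new by blast
    with 3 show ?thesis
      by (intro exI[of _ "rev p"]) (auto simp: hd_rev last_rev is_path_rev)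
  next
    case 4
    then obtain p where "p \<noteq> []" "is_path E p" "set p \<subseteq> V" "hd p = a" "last p = b"
      using leaf.IH by blast
    then show ?thesis by (intro exI[of _ p]) (auto intro: is_path_mono)
  qed
qed

text \<open>Distinct ends give \<open>p\<close> at least two vertices, so the cycle has length at
  least 3. Only the last index wraps around, back to \<open>w\<close>.\<close>

lemma path_closes_cycle:
  assumes p: "is_path (edges G) p" "p \<noteq> []" "hd p \<noteq> last p"
    and w: "w \<notin> set p" "{w, hd p} \<in> edges G" "{last p, w} \<in> edges G"
  shows "graph_cycle G (w # p)"
proof -
  have len: "length p \<ge> 2"
    using p by (cases p; cases "tl p") auto
  have "is_path (edges G) (w # p)" using p w by (intro is_path_Cons) auto
  then have *: "distinct (w # p)" "Suc i < length (w # p) \<Longrightarrow> {(w # p) ! i, (w # p) ! Suc i} \<in> edges G" for i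
    unfolding is_path_def by blast+
  have "{(w # p) ! i, (w # p) ! (Suc i mod length (w # p))} \<in> edges G" if i: "i < length (w # p)" for i
  proof (cases "Suc i < length (w # p)")
    case True
    then show ?thesis using *(2)[OF True] by simp
  next
    case False
    with i have "i = length p" by simp
    then show ?thesis using w p by (simp add: last_conv_nth nth_Cons' )
  qed
  then show ?thesis using len * unfolding graph_cycle_def by auto
qed

lemma rtrancl_leaves_set:
  assumes "(u, v) \<in> R\<^sup>*" "u \<in> S" "v \<notin> S"
  obtains a b where "(a, b) \<in> R" "a \<in> S" "b \<notin> S"
  using assms by (induction rule: rtrancl_induct) blast+

text \<open>Among the vertex sets whose induced edges form a leafwise structure, a largest one is
  taken. If it misses a vertex, connectedness gives an edge \<open>{a, w}\<close> leaving it, and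
  acyclicity makes this the only edge from \<open>w\<close> into the set, so \<open>w\<close> could
  still be attached as a leaf.\<close>

lemma tree_leafwise:
  assumes "tree T"
  shows "leafwise (verts T) (edges T)"
proof -
  let ?in = "\<lambda>S. {e \<in> edges T. e \<subseteq> S}"
  let ?P = "\<lambda>S. S \<subseteq> verts T \<and> leafwise S (?in S)"
  have fin: "finite (verts T)" and ed: "\<And>e. e \<in> edges T \<Longrightarrow> e \<subseteq> verts T \<and> card e = 2"
    and acyc: "\<And>c. \<not> graph_cycle T c" and conn: "graph_connected T"
    using assms by (auto simp: tree_def simple_graph_def)
  obtain r where r: "r \<in> verts T" using conn by (auto simp: graph_connected_def)
  have in_r: "?in {r} = {}"
    by (auto simp: subset_singleton_iff dest!: ed)
  have "?P {r}" unfolding in_r using r by (auto intro: leafwise.single)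
  moreover have "card S < Suc (card (verts T))" if "?P S" for S
    using that fin by (auto simp: less_Suc_eq_le intro: card_mono)
  ultimately obtain S where S: "?P S" and max: "\<And>S'. ?P S' \<Longrightarrow> card S' \<le> card S"
    using ex_has_greatest_nat[of ?P "{r}" card "Suc (card (verts T))"] by blast
  have "S = verts T"
  proof (rule ccontr)
    assume "S \<noteq> verts T"
    with S obtain v where v: "v \<in> verts T" "v \<notin> S" by blast
    obtain u where u: "u \<in> S" using leafwise_finite S by blast
    with S v conn have "(u, v) \<in> {(a, b). {a, b} \<in> edges T}\<^sup>*"
      by (auto simp: graph_connected_def)
    then obtain a w where aw: "{a, w} \<in> edges T" "a \<in> S" "w \<notin> S"
      using u v by (elim rtrancl_leaves_set) auto
    \<comment> \<open>A second neighbour \<open>b\<close> of \<open>w\<close> would close a cycle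
      through \<open>w\<close> and a path from \<open>a\<close> to \<open>b\<close> inside
      \<open>S\<close>.\<close>
    have uniq: "b = a" if b: "b \<in> S" "{b, w} \<in> edges T" for b
    proof (rule ccontr)
      assume "b \<noteq> a"
      obtain p where p: "p \<noteq> []" "is_path (?in S) p" "set p \<subseteq> S" "hd p = a" "last p = b"
        using leafwise_path[of S _ a b] S aw b by blast
      have "graph_cycle T (w # p)"
        using p aw b \<open>b \<noteq> a\<close> by (intro path_closes_cycle) (auto simp: insert_commute intro: is_path_mono)
      with acyc show False by blast
    qed
    have "?in (insert w S) = insert {a, w} (?in S)"
    proof (intro equalityI subsetI)
      fix e assume e: "e \<in> ?in (insert w S)"
      show "e \<in> insert {a, w} (?in S)"
      proof (cases "w \<in> e")
        case True
        then obtain b where "e = {b, w}" "b \<noteq> w"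
          using e ed[of e] by (auto simp: card_2_iff insert_commute)
        with e uniq[of b] show ?thesis by auto
      next
        case False
        with e show ?thesis by auto
      qed
    qed (use aw in auto)
    then have "?P (insert w S)"
      using S aw ed[OF aw(1)] leafwise.leaf[of S "?in S" a w] by simp
    then have "card (insert w S) \<le> card S" by (rule max)
    moreover have "finite S" using S fin finite_subset by blast
    ultimately show False using aw by simp
  qed
  moreover have "?in (verts T) = edges T" using ed by auto
  ultimately show ?thesis using S by simp
qed

subsection \<open>Functions bounded between positive constants\<close>

text \<open>The lower bound keeps integrals positive and logarithms bounded; the upper bound gives
  integrability over finite measures. The class is closed under products, inverses and partial
  integration over a probability space, so side conditions can be settled by composition.\<close>

definition pos_bdd :: "'b measure \<Rightarrow> ('b \<Rightarrow> real) \<Rightarrow> bool" where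
  "pos_bdd M g \<longleftrightarrow> g \<in> borel_measurable M \<and> (\<exists>a>0. \<exists>b. \<forall>x\<in>space M. a \<le> g x \<and> g x \<le> b)"

lemma pos_bdd_measurable: "pos_bdd M g \<Longrightarrow> g \<in> borel_measurable M"
  by (simp add: pos_bdd_def)

lemma pos_bdd_pos: "pos_bdd M g \<Longrightarrow> x \<in> space M \<Longrightarrow> 0 < g x"
  unfolding pos_bdd_def by (meson order_less_le_trans)

lemma pos_bdd_const: "0 < a \<Longrightarrow> pos_bdd M (\<lambda>_. a)"
  by (auto simp: pos_bdd_def)

lemma pos_bdd_mult:
  assumes "pos_bdd M g" "pos_bdd M h"
  shows "pos_bdd M (\<lambda>x. g x * h x)"
proof -
  obtain a b a' b' where "0 < a" "0 < a'" "\<forall>x\<in>space M. a \<le> g x \<and> g x \<le> b"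
      "\<forall>x\<in>space M. a' \<le> h x \<and> h x \<le> b'"
    using assms by (auto simp: pos_bdd_def)
  then have "\<forall>x\<in>space M. a * a' \<le> g x * h x \<and> g x * h x \<le> b * b'"
    by (intro ballI conjI mult_mono) (auto intro: order.trans[OF less_imp_le])
  with \<open>0 < a\<close> \<open>0 < a'\<close> have "\<exists>a>0. \<exists>b. \<forall>x\<in>space M. a \<le> g x * h x \<and> g x * h x \<le> b"
    by (intro exI[of _ "a * a'"]) auto
  moreover have "(\<lambda>x. g x * h x) \<in> borel_measurable M"
    using assms by (intro borel_measurable_times pos_bdd_measurable)
  ultimately show ?thesis unfolding pos_bdd_def by blast
qed

lemma pos_bdd_inverse:
  assumes "pos_bdd M g"
  shows "pos_bdd M (\<lambda>x. inverse (g x))"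
proof -
  obtain a b where ab: "0 < a" "\<forall>x\<in>space M. a \<le> g x \<and> g x \<le> b"
    using assms by (auto simp: pos_bdd_def)
  \<comment> \<open>\<open>b\<close> need not be positive when the space is empty;
    \<open>max a b\<close> always is.\<close>
  have "inverse (max a b) \<le> inverse (g x) \<and> inverse (g x) \<le> inverse a" if "x \<in> space M" for x
    using ab(1) ab(2)[rule_format, OF that] by (auto intro!: le_imp_inverse_le)
  with ab have "\<exists>a>0. \<exists>b. \<forall>x\<in>space M. a \<le> inverse (g x) \<and> inverse (g x) \<le> b"
    by (intro exI[of _ "inverse (max a b)"]) (auto simp: less_max_iff_disj)
  moreover have "(\<lambda>x. inverse (g x)) \<in> borel_measurable M"
    using assms by (intro borel_measurable_inverse pos_bdd_measurable)
  ultimately show ?thesis unfolding pos_bdd_def by blast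
qed

lemma pos_bdd_prod:
  assumes "finite I" "\<And>i. i \<in> I \<Longrightarrow> pos_bdd M (g i)"
  shows "pos_bdd M (\<lambda>x. \<Prod>i\<in>I. g i x)"
  using assms by (induction I rule: finite_induct) (auto intro: pos_bdd_const pos_bdd_mult)

lemma pos_bdd_compose:
  assumes "pos_bdd M g" "h \<in> measurable N M"
  shows "pos_bdd N (\<lambda>x. g (h x))"
proof -
  have "(\<lambda>x. g (h x)) \<in> borel_measurable N"
    using assms by (auto simp: pos_bdd_def intro: measurable_compose)
  moreover have "\<And>x. x \<in> space N \<Longrightarrow> h x \<in> space M"
    using assms(2) by (rule measurable_space)
  moreover obtain a b where "0 < a" "\<forall>x\<in>space M. a \<le> g x \<and> g x \<le> b"
    using assms(1) by (auto simp: pos_bdd_def)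
  ultimately show ?thesis
    unfolding pos_bdd_def by (intro conjI exI[of _ a] exI[of _ b]) auto
qed

lemma (in finite_measure) pos_bdd_integrable:
  assumes "pos_bdd M g"
  shows "integrable M g"
proof -
  obtain a b where "0 < a" "\<forall>x\<in>space M. a \<le> g x \<and> g x \<le> b"
    using assms by (auto simp: pos_bdd_def)
  then have "AE x in M. norm (g x) \<le> b" by (intro AE_I2) force
  then show ?thesis using pos_bdd_measurable[OF assms] by (rule integrable_const_bound)
qed

lemma (in finite_measure) pos_bdd_integrable_ln:
  assumes "pos_bdd M g" "pos_bdd M h"
  shows "integrable M (\<lambda>x. g x * ln (h x))"
proof -
  obtain a b a' b' where *: "0 < a" "0 < a'" "\<forall>x\<in>space M. a \<le> g x \<and> g x \<le> b"
      "\<forall>x\<in>space M. a' \<le> h x \<and> h x \<le> b'"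
    using assms by (auto simp: pos_bdd_def)
  have "\<bar>g x * ln (h x)\<bar> \<le> b * max \<bar>ln a'\<bar> \<bar>ln b'\<bar>" if x: "x \<in> space M" for x
  proof -
    have "0 < g x" "g x \<le> b" "0 < h x" "a' \<le> h x" "h x \<le> b'"
      using * x by (auto intro: less_le_trans)
    then have "ln a' \<le> ln (h x)" "ln (h x) \<le> ln b'"
      using \<open>0 < a'\<close> by auto
    then have "\<bar>ln (h x)\<bar> \<le> max \<bar>ln a'\<bar> \<bar>ln b'\<bar>" by linarith
    then show ?thesis
      using \<open>0 < g x\<close> \<open>g x \<le> b\<close> unfolding abs_mult by (intro mult_mono) auto
  qed
  moreover have "(\<lambda>x. g x * ln (h x)) \<in> borel_measurable M"
    using assms by (auto simp: pos_bdd_def)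
  ultimately show ?thesis
    by (intro integrable_const_bound[of _ "b * max \<bar>ln a'\<bar> \<bar>ln b'\<bar>"]) auto
qed

text \<open>Averaging a section over a probability measure keeps it between the same two
  constants.\<close>

lemma (in prob_space) pos_bdd_integral_param:
  assumes "pos_bdd (N \<Otimes>\<^sub>M M) (\<lambda>(x, y). F x y)"
  shows "pos_bdd N (\<lambda>x. \<integral>y. F x y \<partial>M)"
proof -
  obtain a b where ab: "0 < a" "\<forall>z\<in>space (N \<Otimes>\<^sub>M M). a \<le> (case z of (x, y) \<Rightarrow> F x y) \<and> (case z of (x, y) \<Rightarrow> F x y) \<le> b"
    using assms by (auto simp: pos_bdd_def)
  have m: "(\<lambda>(x, y). F x y) \<in> borel_measurable (N \<Otimes>\<^sub>M M)"
    using assms by (rule pos_bdd_measurable)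
  have "a \<le> (\<integral>y. F x y \<partial>M) \<and> (\<integral>y. F x y \<partial>M) \<le> b" if x: "x \<in> space N" for x
  proof -
    have *: "\<forall>y\<in>space M. a \<le> F x y \<and> F x y \<le> b"
      using ab(2) x by (auto simp: space_pair_measure)
    moreover have "(\<lambda>y. F x y) \<in> borel_measurable M"
      using measurable_Pair2[OF m x] by simp
    ultimately have "pos_bdd M (F x)" using ab(1) by (auto simp: pos_bdd_def)
    then have int: "integrable M (F x)" by (rule pos_bdd_integrable)
    show ?thesis
      using * by (auto intro!: integral_ge_const integral_le_const int)
  qed
  moreover have "(\<lambda>x. \<integral>y. F x y \<partial>M) \<in> borel_measurable N"
    using m by (rule borel_measurable_lebesgue_integral)
  ultimately show ?thesis using ab(1) by (auto simp: pos_bdd_def)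
qed

lemma (in prob_space) pos_bdd_integral_pos:
  assumes "pos_bdd M g"
  shows "0 < (\<integral>x. g x \<partial>M)"
proof -
  obtain a where "0 < a" "\<forall>x\<in>space M. a \<le> g x"
    using assms by (auto simp: pos_bdd_def)
  then have "a \<le> (\<integral>x. g x \<partial>M)"
    using pos_bdd_integrable[OF assms] by (intro integral_ge_const) auto
  with \<open>0 < a\<close> show ?thesis by simp
qed

lemma pos_bdd_Fubini:
  assumes "prob_space M" "prob_space N" "pos_bdd (M \<Otimes>\<^sub>M N) (\<lambda>(x, y). F x y)"
  shows "(\<integral>x. (\<integral>y. F x y \<partial>N) \<partial>M) = (\<integral>y. (\<integral>x. F x y \<partial>M) \<partial>N)"
proof -
  interpret M: prob_space M by fact
  interpret N: prob_space N by fact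
  interpret P: pair_prob_space M N ..
  show ?thesis
    using P.Fubini_integral[OF P.pos_bdd_integrable[OF assms(3)]] by simp
qed

text \<open>With \<open>G\<close> the \<open>p\<close>-weighted mean of \<open>g\<close>, the bound
  \<open>ln s \<le> s - 1\<close> at \<open>s = g x / G\<close> is integrated against
  \<open>p\<close>; its right-hand side vanishes on average. The weight \<open>p\<close> is left
  unnormalised.\<close>

lemma (in prob_space) Jensen_ln:
  assumes p: "pos_bdd M p" and g: "pos_bdd M g"
  defines "P \<equiv> \<integral>x. p x \<partial>M"
  shows "(\<integral>x. p x * ln (g x) \<partial>M) \<le> P * ln ((\<integral>x. p x * g x \<partial>M) / P)"
proof -
  have P: "0 < P" unfolding P_def by (rule pos_bdd_integral_pos[OF p])
  define G where "G = (\<integral>x. p x * g x \<partial>M) / P"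
  have G: "0 < G"
    unfolding G_def using pos_bdd_integral_pos[OF pos_bdd_mult[OF p g]] P by simp
  have "(\<integral>x. p x * ln (g x) \<partial>M) \<le> (\<integral>x. p x * (ln G - 1) + p x * g x / G \<partial>M)"
  proof (rule integral_mono)
    show "integrable M (\<lambda>x. p x * ln (g x))" by (rule pos_bdd_integrable_ln[OF p g])
    show "integrable M (\<lambda>x. p x * (ln G - 1) + p x * g x / G)"
      using pos_bdd_integrable[OF p] pos_bdd_integrable[OF pos_bdd_mult[OF p g]] by simp
    fix x assume x: "x \<in> space M"
    have "ln (g x / G) \<le> g x / G - 1"
      using pos_bdd_pos[OF g x] G by (intro ln_le_minus_one) simp
    then have "ln (g x) \<le> (ln G - 1) + g x / G"
      using pos_bdd_pos[OF g x] G by (simp add: ln_div)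
    then have "p x * ln (g x) \<le> p x * ((ln G - 1) + g x / G)"
      using pos_bdd_pos[OF p x] by (intro mult_left_mono) auto
    then show "p x * ln (g x) \<le> p x * (ln G - 1) + p x * g x / G"
      by (simp add: algebra_simps)
  qed
  also have "\<dots> = P * (ln G - 1) + (\<integral>x. p x * g x \<partial>M) / G"
    using pos_bdd_integrable[OF p] pos_bdd_integrable[OF pos_bdd_mult[OF p g]] by (simp add: P_def)
  also have "(\<integral>x. p x * g x \<partial>M) / G = P"
    using G P unfolding G_def by (auto simp: field_simps)
  finally show ?thesis by (simp add: G_def algebra_simps)
qed

text \<open>The left-hand side is the tangent of \<open>a ^ n\<close> at \<open>a = t\<close>. Being
  affine in \<open>a\<close>, it can be integrated and summed afterwards.\<close>

lemma power_ge_tangent: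
  fixes a t :: real
  assumes "0 \<le> a" "0 < t"
  shows "t ^ n * (1 + real n * (a / t - 1)) \<le> a ^ n"
proof -
  have "1 + real n * (a / t - 1) \<le> (1 + (a / t - 1)) ^ n"
    using assms by (intro Bernoulli_inequality) simp
  then have "t ^ n * (1 + real n * (a / t - 1)) \<le> t ^ n * (a / t) ^ n"
    using assms by (intro mult_left_mono) auto
  also have "\<dots> = a ^ n" using assms by (simp flip: power_mult_distrib)
  finally show ?thesis .
qed

subsection \<open>Tree densities in weighted kernels\<close>

definition edge_val :: "('b \<Rightarrow> 'b \<Rightarrow> real) \<Rightarrow> ('a \<Rightarrow> 'b) \<Rightarrow> 'a set \<Rightarrow> real" where
  "edge_val W x e = (case edge_ends e of (u, v) \<Rightarrow> W (x u) (x v))"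

text \<open>Symmetry is required for all arguments, not only for points of the space, so that the
  value on \<open>{u, v}\<close> is independent of the chosen orientation without side
  conditions.\<close>

locale sym_kernel = prob_space M for M :: "'b measure" +
  fixes W :: "'b \<Rightarrow> 'b \<Rightarrow> real"
  assumes pos_bdd_W: "pos_bdd (M \<Otimes>\<^sub>M M) (\<lambda>(x, y). W x y)"
    and W_sym: "W x y = W y x"
begin

lemma edge_val_pair: "edge_val W x {u, v} = W (x u) (x v)"
  unfolding edge_val_def by (rule edge_ends_symmetric) (rule W_sym)

lemma pos_bdd_W_compose:
  assumes "g \<in> measurable N M" "h \<in> measurable N M"
  shows "pos_bdd N (\<lambda>z. W (g z) (h z))"
  using pos_bdd_compose[OF pos_bdd_W measurable_Pair[OF assms]] by simp

lemma pos_bdd_edge_val: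
  assumes "u \<in> V" "v \<in> V"
  shows "pos_bdd (PiM V (\<lambda>_. M)) (\<lambda>x. edge_val W x {u, v})"
  unfolding edge_val_pair using assms
  by (intro pos_bdd_W_compose measurable_component_singleton)

lemma pos_bdd_leafwise:
  assumes "leafwise V E" "\<And>v. v \<in> V \<Longrightarrow> pos_bdd M (h v)"
  shows "pos_bdd (PiM V (\<lambda>_. M)) (\<lambda>x. (\<Prod>v\<in>V. h v (x v)) * (\<Prod>e\<in>E. edge_val W x e))"
proof (intro pos_bdd_mult pos_bdd_prod)
  show "pos_bdd (PiM V (\<lambda>_. M)) (\<lambda>x. h v (x v))" if "v \<in> V" for v
    using that assms(2) by (intro pos_bdd_compose[of M "h v" "\<lambda>x. x v"] measurable_component_singleton)
  show "pos_bdd (PiM V (\<lambda>_. M)) (\<lambda>x. edge_val W x e)" if "e \<in> E" for e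
  proof -
    obtain a b where "e = {a, b}" "a \<in> V" "b \<in> V" by (rule leafwise_edge[OF assms(1) \<open>e \<in> E\<close>])
    then show ?thesis by (simp add: pos_bdd_edge_val)
  qed
qed (use leafwise_finite[OF assms(1)] in auto)

text \<open>Fubini in the coordinate \<open>w\<close>: only the vertex factor of \<open>w\<close>
  and the edge \<open>{v, w}\<close> depend on it. Integrating them out leaves a function of
  \<open>x v\<close>, which is absorbed into the vertex factor of \<open>v\<close>.\<close>

lemma leafwise_integral_leaf:
  assumes VE: "leafwise V E" and v: "v \<in> V" and w: "w \<notin> V"
    and h: "\<And>u. u \<in> insert w V \<Longrightarrow> pos_bdd M (h u)"
  shows "(\<integral>x. (\<Prod>u\<in>insert w V. h u (x u)) * (\<Prod>e\<in>insert {v, w} E. edge_val W x e)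
             \<partial>PiM (insert w V) (\<lambda>_. M))
       = (\<integral>x. (\<Prod>u\<in>V. (h(v := \<lambda>z. h v z * (\<integral>y. W z y * h w y \<partial>M))) u (x u)) *
             (\<Prod>e\<in>E. edge_val W x e) \<partial>PiM V (\<lambda>_. M))"
proof -
  interpret P: product_prob_space "\<lambda>_. M" UNIV ..
  have fin: "finite V" "finite E" using leafwise_finite[OF VE] by auto
  have b: "pos_bdd (PiM (insert w V) (\<lambda>_. M))
      (\<lambda>x. (\<Prod>u\<in>insert w V. h u (x u)) * (\<Prod>e\<in>insert {v, w} E. edge_val W x e))"
    by (rule pos_bdd_leafwise[OF leafwise.leaf[OF VE v w] h])
  interpret Q: prob_space "PiM (insert w V) (\<lambda>_. M)"
    by (intro prob_space_PiM prob_space_axioms)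
  have vw: "{v, w} \<notin> E" using leafwise_edge[OF VE] w by (metis insertCI insertE singletonD)
  have step: "(\<Prod>u\<in>insert w V. h u ((x(w := y)) u)) * (\<Prod>e\<in>insert {v, w} E. edge_val W (x(w := y)) e)
      = (\<Prod>u\<in>V. h u (x u)) * (\<Prod>e\<in>E. edge_val W x e) * (W (x v) y * h w y)" for x y
  proof -
    have "edge_val W (x(w := y)) e = edge_val W x e" if "e \<in> E" for e
    proof -
      obtain a b where "e = {a, b}" "a \<in> V" "b \<in> V" by (rule leafwise_edge[OF VE \<open>e \<in> E\<close>])
      with w show ?thesis by (auto simp: edge_val_pair)
    qed
    moreover have "edge_val W (x(w := y)) {v, w} = W (x v) y"
      using v w by (auto simp: edge_val_pair)
    moreover have "(\<Prod>u\<in>V. h u ((x(w := y)) u)) = (\<Prod>u\<in>V. h u (x u))"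
      using w by (intro prod.cong) auto
    ultimately show ?thesis using fin w vw by simp
  qed
  have remove: "(\<Prod>u\<in>V. h u (x u)) * (\<integral>y. W (x v) y * h w y \<partial>M)
      = (\<Prod>u\<in>V. (h(v := \<lambda>z. h v z * (\<integral>y. W z y * h w y \<partial>M))) u (x u))" for x
  proof -
    have "(\<Prod>u\<in>V - {v}. (h(v := \<lambda>z. h v z * (\<integral>y. W z y * h w y \<partial>M))) u (x u)) = (\<Prod>u\<in>V - {v}. h u (x u))"
      by (intro prod.cong) auto
    then show ?thesis using fin v by (simp add: prod.remove[of V v])
  qed
  show ?thesis
    unfolding P.product_integral_insert[OF fin(1) w Q.pos_bdd_integrable[OF b]] step
    by (intro Bochner_Integration.integral_cong refl)
       (simp only: integral_mult_right_zero remove[symmetric], simp only: mult_ac)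
qed

end

section \<open>Entropy bound for trees with a vertex weight\<close>

locale weighted_kernel = sym_kernel M W for M :: "'b measure" and W +
  fixes f :: "'b \<Rightarrow> real"
  assumes pos_bdd_f: "pos_bdd M f"
begin

text \<open>The degree with respect to the weight \<open>f\<close>. Below, \<open>mass\<close> and
  \<open>edge_mass\<close> are the F and E of the overview at the beginning;
  \<open>edge_mass\<close> is the total mass of the unnormalised stationary density
  \<open>f x * wdeg x\<close>.\<close>

definition wdeg :: "'b \<Rightarrow> real" where "wdeg x = (\<integral>y. W x y * f y \<partial>M)"

definition mass :: real where "mass = (\<integral>x. f x \<partial>M)"

definition edge_mass :: real where "edge_mass = (\<integral>x. f x * wdeg x \<partial>M)"

lemma pos_bdd_kernel_integral: "pos_bdd M h \<Longrightarrow> pos_bdd M (\<lambda>x. \<integral>y. W x y * h y \<partial>M)"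
proof -
  assume h: "pos_bdd M h"
  have "pos_bdd (M \<Otimes>\<^sub>M M) (\<lambda>z. W (fst z) (snd z) * h (snd z))"
    by (intro pos_bdd_mult pos_bdd_W_compose pos_bdd_compose[OF h measurable_snd] measurable_fst measurable_snd)
  then show ?thesis by (intro pos_bdd_integral_param) (simp add: case_prod_unfold)
qed

lemma pos_bdd_wdeg: "pos_bdd M wdeg"
  unfolding wdeg_def using pos_bdd_f by (rule pos_bdd_kernel_integral)

lemma wdeg_nz: "x \<in> space M \<Longrightarrow> wdeg x \<noteq> 0"
  using pos_bdd_pos[OF pos_bdd_wdeg] by (metis less_irrefl)

lemma pos_bdd_flow: "pos_bdd M (\<lambda>x. f x * wdeg x)"
  using pos_bdd_f pos_bdd_wdeg by (rule pos_bdd_mult)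

lemma mass_pos: "0 < mass"
  unfolding mass_def by (rule pos_bdd_integral_pos[OF pos_bdd_f])

lemma edge_mass_pos: "0 < edge_mass"
  unfolding edge_mass_def by (rule pos_bdd_integral_pos[OF pos_bdd_flow])

text \<open>Up to normalisation, \<open>f x * wdeg x\<close> is the density of the stationary distribution.\<close>

abbreviation flow_ln :: "('b \<Rightarrow> real) \<Rightarrow> real" where
  "flow_ln h \<equiv> \<integral>x. f x * wdeg x * ln (h x) \<partial>M"

lemma flow_ln_mult:
  assumes "pos_bdd M g" "pos_bdd M h"
  shows "flow_ln (\<lambda>x. g x * h x) = flow_ln g + flow_ln h"
proof -
  have "flow_ln (\<lambda>x. g x * h x) = (\<integral>x. f x * wdeg x * ln (g x) + f x * wdeg x * ln (h x) \<partial>M)"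
    using pos_bdd_pos[OF assms(1)] pos_bdd_pos[OF assms(2)]
    by (intro Bochner_Integration.integral_cong refl) (simp add: ln_mult_pos algebra_simps)
  then show ?thesis
    using pos_bdd_integrable_ln[OF pos_bdd_flow] assms by simp
qed

lemma flow_ln_inverse:
  assumes "pos_bdd M h"
  shows "flow_ln (\<lambda>x. inverse (h x)) = - flow_ln h"
proof -
  have "flow_ln (\<lambda>x. inverse (h x)) = (\<integral>x. - (f x * wdeg x * ln (h x)) \<partial>M)"
    using pos_bdd_pos[OF assms]
    by (intro Bochner_Integration.integral_cong refl) (simp add: ln_inverse less_imp_neq)
  then show ?thesis by simp
qed

text \<open>The random walk moves from \<open>x\<close> to \<open>y\<close> with density
  \<open>W x y * f y / wdeg x\<close>. Jensen for one step bounds the expected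
  \<open>ln (r y)\<close> by \<open>ln (g x / wdeg x)\<close>, and averaging over a stationary start
  turns the expectation into \<open>flow_ln r\<close>.\<close>

lemma flow_ln_step:
  assumes r: "pos_bdd M r"
  shows "flow_ln wdeg + flow_ln r \<le> flow_ln (\<lambda>x. \<integral>y. W x y * (f y * r y) \<partial>M)"
proof -
  define g where "g x = (\<integral>y. W x y * (f y * r y) \<partial>M)" for x
  have g: "pos_bdd M g" unfolding g_def by (intro pos_bdd_kernel_integral pos_bdd_mult pos_bdd_f r)
  have step: "(\<integral>y. f x * W x y * f y * ln (r y) \<partial>M) \<le> f x * wdeg x * ln (g x / wdeg x)"
    if x: "x \<in> space M" for x
  proof -
    have "pos_bdd M (\<lambda>y. W x y * f y)"
      using x by (intro pos_bdd_mult pos_bdd_W_compose pos_bdd_f) auto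
    from Jensen_ln[OF this r]
    have "(\<integral>y. W x y * f y * ln (r y) \<partial>M) \<le> wdeg x * ln (g x / wdeg x)"
      by (simp add: wdeg_def g_def mult.assoc)
    then have "f x * (\<integral>y. W x y * f y * ln (r y) \<partial>M) \<le> f x * (wdeg x * ln (g x / wdeg x))"
      using pos_bdd_pos[OF pos_bdd_f x] by (intro mult_left_mono) auto
    then show ?thesis by (simp add: mult.assoc)
  qed
  interpret MM: pair_prob_space M M ..
  have W2: "pos_bdd (M \<Otimes>\<^sub>M M) (\<lambda>z. f (fst z) * W (fst z) (snd z) * f (snd z))"
    by (intro pos_bdd_mult pos_bdd_W_compose pos_bdd_compose[OF pos_bdd_f measurable_fst]
        pos_bdd_compose[OF pos_bdd_f measurable_snd] measurable_fst measurable_snd)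
  have int: "integrable (M \<Otimes>\<^sub>M M) (\<lambda>(x, y). f x * W x y * f y * ln (r y))"
    using MM.pos_bdd_integrable_ln[OF W2 pos_bdd_compose[OF r measurable_snd]] by (simp add: case_prod_unfold)
  \<comment> \<open>Stationarity: as \<open>W\<close> is symmetric, integrating out the start
    \<open>x\<close> leaves the weight \<open>f y * wdeg y\<close> at the endpoint.\<close>
  have "flow_ln r = (\<integral>y. (\<integral>x. f x * W x y * f y * ln (r y) \<partial>M) \<partial>M)"
  proof (intro Bochner_Integration.integral_cong refl)
    fix y
    have "(\<integral>x. f x * W x y * f y * ln (r y) \<partial>M) = (\<integral>x. W y x * f x * (f y * ln (r y)) \<partial>M)"
      by (intro Bochner_Integration.integral_cong refl) (simp add: W_sym mult_ac)
    also have "\<dots> = wdeg y * (f y * ln (r y))"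
      unfolding wdeg_def by (rule integral_mult_left_zero)
    finally show "f y * wdeg y * ln (r y) = (\<integral>x. f x * W x y * f y * ln (r y) \<partial>M)"
      by (simp only: mult_ac)
  qed
  also have "\<dots> = (\<integral>x. (\<integral>y. f x * W x y * f y * ln (r y) \<partial>M) \<partial>M)"
    by (rule MM.Fubini_integral[OF int])
  also have "\<dots> \<le> (\<integral>x. f x * wdeg x * ln (g x / wdeg x) \<partial>M)"
  proof (rule integral_mono)
    show "integrable M (\<lambda>x. \<integral>y. f x * W x y * f y * ln (r y) \<partial>M)"
      using MM.integrable_fst'[OF int] by simp
    show "integrable M (\<lambda>x. f x * wdeg x * ln (g x / wdeg x))"
      unfolding divide_inverse by (intro pos_bdd_integrable_ln pos_bdd_flow pos_bdd_mult pos_bdd_inverse g pos_bdd_wdeg)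
  qed (rule step)
  also have "\<dots> = flow_ln g - flow_ln wdeg"
    unfolding divide_inverse flow_ln_mult[OF g pos_bdd_inverse[OF pos_bdd_wdeg]] flow_ln_inverse[OF pos_bdd_wdeg]
    by simp
  finally show ?thesis unfolding g_def by simp
qed

text \<open>The induction attaches leaves, so it has to carry arbitrary vertex factors \<open>r v\<close>: integrating out
  a leaf multiplies the factor of its neighbour.\<close>

lemma leafwise_entropy:
  assumes "leafwise V E" "\<And>v. v \<in> V \<Longrightarrow> pos_bdd M (r v)"
  shows "(\<Sum>v\<in>V. flow_ln (r v)) + (real (card E) - 1) * flow_ln wdeg \<le>
    edge_mass * ln ((\<integral>x. (\<Prod>v\<in>V. f (x v) * r v (x v)) * (\<Prod>e\<in>E. edge_val W x e)
      \<partial>PiM V (\<lambda>_. M)) / edge_mass)"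
  using assms
proof (induction arbitrary: r rule: leafwise.induct)
  case (single v)
  interpret P: product_prob_space "\<lambda>_. M" UNIV ..
  have r: "pos_bdd M (r v)" using single by simp
  \<comment> \<open>Without edges the coefficient of \<open>flow_ln wdeg\<close> is -1, so Jensen is
    applied to \<open>r v x / wdeg x\<close>; the weight \<open>f x * wdeg x\<close> turns this back
    into \<open>f x * r v x\<close>.\<close>
  have "flow_ln (r v) - flow_ln wdeg = (\<integral>x. f x * wdeg x * ln (r v x * inverse (wdeg x)) \<partial>M)"
    using flow_ln_mult[OF r pos_bdd_inverse[OF pos_bdd_wdeg]] flow_ln_inverse[OF pos_bdd_wdeg] by simp
  also have "\<dots> \<le> edge_mass * ln ((\<integral>x. f x * wdeg x * (r v x * inverse (wdeg x)) \<partial>M) / edge_mass)"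
    unfolding edge_mass_def by (intro Jensen_ln pos_bdd_flow pos_bdd_mult pos_bdd_inverse r pos_bdd_wdeg)
  also have "(\<integral>x. f x * wdeg x * (r v x * inverse (wdeg x)) \<partial>M) = (\<integral>x. f x * r v x \<partial>M)"
    by (intro Bochner_Integration.integral_cong refl) (simp add: wdeg_nz)
  also have "\<dots> = (\<integral>x. f (x v) * r v (x v) \<partial>PiM {v} (\<lambda>_. M))"
    using pos_bdd_measurable[OF pos_bdd_mult[OF pos_bdd_f r]] by (subst P.product_integral_singleton) auto
  finally show ?case by simp
next
  case (leaf V E v w)
  have fin: "finite V" "finite E" using leafwise_finite[OF leaf.hyps(1)] by auto
  have r: "pos_bdd M (r u)" if "u \<in> insert w V" for u using leaf.prems that by simp
  have vw: "{v, w} \<notin> E"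
    using leafwise_edge[OF leaf.hyps(1)] leaf.hyps(3) by (metis insertCI insertE singletonD)
  define g where "g x = (\<integral>y. W x y * (f y * r w y) \<partial>M)" for x
  have g: "pos_bdd M g" unfolding g_def using r by (intro pos_bdd_kernel_integral pos_bdd_mult pos_bdd_f) auto
  \<comment> \<open>The leaf \<open>w\<close>, once integrated out, contributes the factor
    \<open>g\<close> at its neighbour \<open>v\<close>.\<close>
  define r' where "r' = r(v := \<lambda>x. r v x * g x)"
  have r': "pos_bdd M (r' u)" if "u \<in> V" for u
    using that r g by (auto simp: r'_def intro: pos_bdd_mult)
  have sum_remove: "(\<Sum>u\<in>V. q u) = q v + (\<Sum>u\<in>V - {v}. q u)" for q :: "_ \<Rightarrow> real"
    by (rule sum.remove[OF fin(1) leaf.hyps(2)])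
  have "(\<Sum>u\<in>V. flow_ln (r' u)) = flow_ln (\<lambda>x. r v x * g x) + (\<Sum>u\<in>V - {v}. flow_ln (r u))"
    unfolding sum_remove by (auto simp: r'_def intro!: sum.cong)
  also have "\<dots> = (\<Sum>u\<in>V. flow_ln (r u)) + flow_ln g"
    using flow_ln_mult[OF r g, of v] leaf.hyps(2) sum_remove[of "\<lambda>u. flow_ln (r u)"] by simp
  finally have sum': "(\<Sum>u\<in>V. flow_ln (r' u)) = (\<Sum>u\<in>V. flow_ln (r u)) + flow_ln g" .
  \<comment> \<open>The new leaf adds \<open>flow_ln (r w)\<close> and one more
    \<open>flow_ln wdeg\<close>; \<open>flow_ln_step\<close> bounds their sum by the
    \<open>flow_ln g\<close> contained in \<open>r'\<close>.\<close>
  have "(\<Sum>u\<in>insert w V. flow_ln (r u)) + (real (card (insert {v, w} E)) - 1) * flow_ln wdeg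
      \<le> (\<Sum>u\<in>V. flow_ln (r' u)) + (real (card E) - 1) * flow_ln wdeg"
    using flow_ln_step[OF r, of w] fin leaf.hyps(3) vw sum' by (simp add: g_def[abs_def] algebra_simps)
  also have "\<dots> \<le> edge_mass * ln ((\<integral>x. (\<Prod>u\<in>V. f (x u) * r' u (x u)) *
      (\<Prod>e\<in>E. edge_val W x e) \<partial>PiM V (\<lambda>_. M)) / edge_mass)"
    by (rule leaf.IH[OF r'])
  also have "(\<integral>x. (\<Prod>u\<in>V. f (x u) * r' u (x u)) * (\<Prod>e\<in>E. edge_val W x e) \<partial>PiM V (\<lambda>_. M))
      = (\<integral>x. (\<Prod>u\<in>insert w V. f (x u) * r u (x u)) * (\<Prod>e\<in>insert {v, w} E. edge_val W x e)
         \<partial>PiM (insert w V) (\<lambda>_. M))"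
  proof -
    have "(\<lambda>z. f z * r' u z) = ((\<lambda>u z. f z * r u z)(v := \<lambda>z. f z * r v z * g z)) u" for u
      by (auto simp: r'_def)
    then have "f (x u) * r' u (x u) = ((\<lambda>u z. f z * r u z)(v := \<lambda>z. f z * r v z * g z)) u (x u)" for x u
      by metis
    then show ?thesis
      using leafwise_integral_leaf[OF leaf.hyps, of "\<lambda>u z. f z * r u z"] pos_bdd_mult[OF pos_bdd_f r]
      unfolding g_def by presburger
  qed
  finally show ?case .
qed

text \<open>With all factors \<open>r v\<close> equal to 1, \<open>leafwise_entropy\<close> bounds
  the integral below through \<open>flow_ln wdeg\<close>, which is at least
  \<open>edge_mass * ln (edge_mass / mass)\<close> by Jensen for \<open>1 / wdeg\<close>.
  Exponentiating gives \<open>mass * (edge_mass / mass) ^ card E\<close>, and the tangent at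
  \<open>l\<close> makes the bound linear in \<open>mass\<close> and
  \<open>edge_mass\<close>.\<close>

lemma leafwise_integral_ge:
  assumes VE: "leafwise V E" and l: "0 < l"
  shows "l ^ card E * (mass + real (card E) * (edge_mass / l - mass)) \<le>
    (\<integral>x. (\<Prod>v\<in>V. f (x v)) * (\<Prod>e\<in>E. edge_val W x e) \<partial>PiM V (\<lambda>_. M))" (is "_ \<le> ?I")
proof (cases "card E = 0")
  \<comment> \<open>Here both sides equal \<open>mass\<close>. The entropy bound is set aside
    because its coefficient \<open>card E - 1\<close> would be negative.\<close>
  case True
  then obtain v where v: "V = {v}" "E = {}"
    using leafwise_card[OF VE] leafwise_finite[OF VE] by (auto simp: card_1_singleton_iff)
  interpret P: product_prob_space "\<lambda>_. M" UNIV ..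
  show ?thesis
    using v pos_bdd_measurable[OF pos_bdd_f] by (simp add: mass_def P.product_integral_singleton)
next
  case False
  \<comment> \<open>\<open>m\<close> is one less than the number of edges: the coefficient of
    \<open>flow_ln wdeg\<close> in \<open>leafwise_entropy\<close>.\<close>
  then obtain m where m: "card E = Suc m" by (metis not0_implies_Suc)
  interpret Q: prob_space "PiM V (\<lambda>_. M)" by (intro prob_space_PiM prob_space_axioms)
  have I: "0 < ?I" using pos_bdd_leafwise[OF VE, of "\<lambda>_. f"] pos_bdd_f by (intro Q.pos_bdd_integral_pos) auto
  have "- flow_ln wdeg = flow_ln (\<lambda>x. inverse (wdeg x))"
    using flow_ln_inverse[OF pos_bdd_wdeg] by simp
  also have "\<dots> \<le> edge_mass * ln ((\<integral>x. f x * wdeg x * inverse (wdeg x) \<partial>M) / edge_mass)"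
    unfolding edge_mass_def by (intro Jensen_ln pos_bdd_flow pos_bdd_inverse pos_bdd_wdeg)
  also have "(\<integral>x. f x * wdeg x * inverse (wdeg x) \<partial>M) = mass"
    unfolding mass_def
    by (intro Bochner_Integration.integral_cong refl) (simp add: wdeg_nz)
  finally have "edge_mass * ln (edge_mass / mass) \<le> flow_ln wdeg"
    using mass_pos edge_mass_pos by (simp add: ln_div algebra_simps)
  then have "real m * (edge_mass * ln (edge_mass / mass)) \<le> real m * flow_ln wdeg"
    by (intro mult_left_mono) auto
  also have "\<dots> \<le> edge_mass * ln (?I / edge_mass)"
    using leafwise_entropy[OF VE, of "\<lambda>_ _. 1"] m by (simp add: pos_bdd_const)
  finally have "edge_mass * (real m * ln (edge_mass / mass)) \<le> edge_mass * ln (?I / edge_mass)"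
    by (simp add: mult_ac)
  then have "real m * ln (edge_mass / mass) \<le> ln (?I / edge_mass)"
    using edge_mass_pos by (simp only: mult_le_cancel_left_pos)
  then have "ln ((edge_mass / mass) ^ m) \<le> ln (?I / edge_mass)"
    using edge_mass_pos mass_pos by (simp only: ln_realpow divide_pos_pos)
  then have "(edge_mass / mass) ^ m \<le> ?I / edge_mass"
    using edge_mass_pos mass_pos I by (subst (asm) ln_le_cancel_iff) auto
  then have *: "mass * (edge_mass / mass) ^ card E \<le> ?I"
    using edge_mass_pos mass_pos m by (simp add: field_simps)
  have "l ^ card E * (1 + real (card E) * (edge_mass / mass / l - 1)) \<le> (edge_mass / mass) ^ card E"
    using edge_mass_pos mass_pos l by (intro power_ge_tangent) auto
  then have "mass * (l ^ card E * (1 + real (card E) * (edge_mass / mass / l - 1)))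
      \<le> mass * (edge_mass / mass) ^ card E"
    using mass_pos by (intro mult_left_mono) auto
  also have "mass * (l ^ card E * (1 + real (card E) * (edge_mass / mass / l - 1)))
      = l ^ card E * (mass + real (card E) * (edge_mass / l - mass))"
    using mass_pos l by (simp add: field_simps)
  finally show ?thesis using * by linarith
qed

end

subsection \<open>Densities of apex graphs\<close>

text \<open>In terms of \<open>u = 2 * d - 1\<close> only even powers of \<open>u\<close> survive,
  and \<open>u ^ 4 \<le> u ^ 2\<close> leaves a quadratic bound, with equality of coefficients at
  \<open>k = 5\<close>. The square of \<open>u\<close> is expanded in the statement so that it
  integrates to star densities.\<close>

lemma symmetric_power_sum_le:
  fixes d :: real
  assumes k: "k \<in> {1, 2, 3, 4, 5}" and d: "0 \<le> d" "d \<le> 1"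
  shows "d ^ k + (1 - d) ^ k \<le> 2 * (1/2) ^ k * (1 + 3 * real k * (4 * d\<^sup>2 - 4 * d + 1))"
proof -
  define u where "u = 2 * d - 1"
  have "\<bar>u\<bar> \<le> 1" using d by (simp add: u_def)
  then have u2: "0 \<le> u\<^sup>2" "u\<^sup>2 \<le> 1" by (simp_all add: abs_square_le_1)
  then have u4: "u\<^sup>2 * u\<^sup>2 \<le> u\<^sup>2" using mult_left_mono[of "u\<^sup>2" 1 "u\<^sup>2"] by simp
  have "(1 + u) ^ k + (1 - u) ^ k \<le> 2 * (1 + 3 * real k * u\<^sup>2)"
  proof -
    have "(1 + u) ^ 2 + (1 - u) ^ 2 = 2 + 2 * u\<^sup>2"
      "(1 + u) ^ 3 + (1 - u) ^ 3 = 2 + 6 * u\<^sup>2"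
      "(1 + u) ^ 4 + (1 - u) ^ 4 = 2 + 12 * u\<^sup>2 + 2 * (u\<^sup>2 * u\<^sup>2)"
      "(1 + u) ^ 5 + (1 - u) ^ 5 = 2 + 20 * u\<^sup>2 + 10 * (u\<^sup>2 * u\<^sup>2)"
      by (simp_all add: eval_nat_numeral algebra_simps)
    \<comment> \<open>What the case \<open>k = 4\<close> reduces to.\<close>
    moreover have "u\<^sup>2 * u\<^sup>2 \<le> 6 * u\<^sup>2" using u2 u4 by linarith
    ultimately show ?thesis using k u4 by auto
  qed
  moreover have "d ^ k + (1 - d) ^ k = (1/2) ^ k * ((1 + u) ^ k + (1 - u) ^ k)"
  proof -
    have "d ^ k = ((1/2) * (1 + u)) ^ k" "(1 - d) ^ k = ((1/2) * (1 - u)) ^ k"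
      by (simp_all add: u_def diff_divide_distrib)
    then show ?thesis by (simp only: power_mult_distrib distrib_left[of "(1/2) ^ k"])
  qed
  moreover have "4 * d\<^sup>2 - 4 * d + 1 = u\<^sup>2" by (simp add: u_def power2_eq_square algebra_simps)
  ultimately show ?thesis by (simp add: power_divide divide_right_mono)
qed

section \<open>Edges of the apex graph\<close>

text \<open>Disjointness and injectivity let products and cardinalities over the edges split into a
  part for the tree and a part for all pairs of a tree vertex and an apex vertex.\<close>

lemma edges_apex:
  fixes G :: "'a graph"
  defines "h \<equiv> \<lambda>(v, i). {Inl v, Inr i} :: ('a + nat) set"
  shows edges_apex_eq: "edges (apex k G) = (`) Inl ` edges G \<union> h ` (verts G \<times> {..<k})"
    and edges_apex_disjoint: "(`) Inl ` edges G \<inter> h ` (verts G \<times> {..<k}) = {}"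
    and edges_apex_inj: "inj_on h (verts G \<times> {..<k})"
proof -
  show "edges (apex k G) = (`) Inl ` edges G \<union> h ` (verts G \<times> {..<k})"
    by (auto simp: h_def apex_def)
  show "(`) Inl ` edges G \<inter> h ` (verts G \<times> {..<k}) = {}"
    by (auto simp: h_def set_eq_iff)
  show "inj_on h (verts G \<times> {..<k})"
    by (auto simp: h_def inj_on_def doubleton_eq_iff)
qed

lemma prod_edges_apex:
  fixes G :: "'a graph"
  assumes "finite (verts G)" "finite (edges G)"
  shows "(\<Prod>e\<in>edges (apex k G). q e) = (\<Prod>e\<in>(`) Inl ` edges G. q e) *
    (\<Prod>v\<in>Inl ` verts G. \<Prod>j\<in>Inr ` {..<k}. q {v, j})"
proof -
  let ?h = "\<lambda>(v, i). {Inl v, Inr i} :: ('a + nat) set"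
  have "prod q (?h ` (verts G \<times> {..<k})) = (\<Prod>v\<in>verts G. \<Prod>i<k. q {Inl v, Inr i})"
    unfolding prod.reindex[OF edges_apex_inj] prod.cartesian_product
    by (simp add: case_prod_unfold comp_def)
  also have "\<dots> = (\<Prod>v\<in>Inl ` verts G. \<Prod>j\<in>Inr ` {..<k}. q {v, j})"
    by (simp add: prod.reindex)
  finally show ?thesis
    unfolding edges_apex_eq using assms by (simp add: prod.union_disjoint[OF _ _ edges_apex_disjoint])
qed

text \<open>A tree with m edges has m + 1 vertices, so the apex has m + k (m + 1) edges.\<close>

lemma card_edges_apex:
  fixes G :: "'a graph"
  assumes "leafwise (verts G) (edges G)"
  shows "card (edges (apex k G)) = card (edges G) * Suc k + k"
proof -
  have fin: "finite (verts G)" "finite (edges G)" using leafwise_finite[OF assms] by auto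
  have "card ((`) (Inl :: 'a \<Rightarrow> 'a + nat) ` edges G) = card (edges G)"
    by (intro card_image) (auto simp: inj_on_def inj_image_eq_iff)
  then show ?thesis
    unfolding edges_apex_eq using fin leafwise_card[OF assms]
    by (simp add: card_Un_disjoint[OF _ _ edges_apex_disjoint] card_image[OF edges_apex_inj]
        card_cartesian_product algebra_simps)
qed

section \<open>Apex densities in terms of stars and books\<close>

context sym_kernel
begin

definition deg :: "'b \<Rightarrow> real" where "deg x = (\<integral>y. W x y \<partial>M)"

definition codeg :: "'b \<Rightarrow> 'b \<Rightarrow> real" where "codeg x y = (\<integral>z. W x z * W y z \<partial>M)"

text \<open>The density of K_{1,k}, with the centre mapped to \<open>x\<close>.\<close>

definition star_density :: "nat \<Rightarrow> real" where
  "star_density k = (\<integral>x. deg x ^ k \<partial>M)"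

text \<open>The density of K_{1,1,k}, that is, of \<open>k\<close> triangles sharing the edge that
  is mapped to \<open>x\<close> and \<open>y\<close>.\<close>

definition book_density :: "nat \<Rightarrow> real" where
  "book_density k = (\<integral>x. (\<integral>y. W x y * codeg x y ^ k \<partial>M) \<partial>M)"

text \<open>The tree vertices are integrated first, with the images of the apex vertices fixed:
  these only enter through the vertex weight in \<open>leafwise_integral_ge\<close>. The resulting
  bound is then averaged over the apex vertices.\<close>

lemma apex_integral_ge:
  fixes G :: "'c graph"
  assumes VE: "leafwise (verts G) (edges G)" and l: "0 < l"
  shows "l ^ card (edges G) * (star_density k + real (card (edges G)) * (book_density k / l - star_density k)) \<le>
    (\<integral>x. (\<Prod>e\<in>edges (apex k G). edge_val W x e) \<partial>PiM (verts (apex k G)) (\<lambda>_. M))"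
proof -
  define I :: "('c + nat) set" where "I = Inr ` {..<k}"
  define V :: "('c + nat) set" where "V = Inl ` verts G"
  define E :: "('c + nat) set set" where "E = (`) Inl ` edges G"
  define N where "N = PiM I (\<lambda>_. M)"
  define f where "f y x = (\<Prod>j\<in>I. W x (y j))" for y x
  \<comment> \<open>\<open>F y\<close> and \<open>H y\<close> are \<open>mass\<close> and
    \<open>edge_mass\<close> for the weight \<open>f y\<close>, where \<open>y\<close> lists the
    images of the apex vertices.\<close>
  define F where "F y = (\<integral>x. f y x \<partial>M)" for y
  define H where "H y = (\<integral>x. f y x * (\<integral>x'. W x x' * f y x' \<partial>M) \<partial>M)" for y
  define m where "m = card (edges G)"
  interpret P: product_prob_space "\<lambda>_. M" UNIV ..
  interpret N: prob_space N unfolding N_def by (intro prob_space_PiM prob_space_axioms)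
  have E: "leafwise V E" unfolding V_def E_def using VE by (intro leafwise_image) auto
  have fin: "finite I" "finite V" "finite E" "I \<inter> V = {}"
    using leafwise_finite[OF E] by (auto simp: I_def V_def)
  have cardI: "card I = k" by (simp add: I_def card_image)
  have cardE: "card E = m"
    unfolding E_def m_def by (intro card_image) (auto simp: inj_on_def inj_image_eq_iff)
  have verts: "verts (apex k G) = I \<union> V" by (auto simp: apex_def I_def V_def)
  define D where "D x = (\<Prod>v\<in>V. \<Prod>j\<in>I. W (x v) (x j)) * (\<Prod>e\<in>E. edge_val W x e)" for x
  have D: "(\<Prod>e\<in>edges (apex k G). edge_val W x e) = D x" for x
    unfolding D_def using leafwise_finite[OF VE]
    by (simp add: prod_edges_apex edge_val_pair I_def V_def E_def mult.commute)
  have bD: "pos_bdd (PiM (I \<union> V) (\<lambda>_. M)) D"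
    unfolding D_def
  proof (intro pos_bdd_mult pos_bdd_prod fin pos_bdd_W_compose)
    show "pos_bdd (PiM (I \<union> V) (\<lambda>_. M)) (\<lambda>x. edge_val W x e)" if "e \<in> E" for e
    proof -
      obtain a b where "e = {a, b}" "a \<in> V" "b \<in> V" by (rule leafwise_edge[OF E \<open>e \<in> E\<close>])
      then show ?thesis by (simp add: pos_bdd_edge_val)
    qed
  qed (auto intro!: measurable_component_singleton)
  have D_merge: "D (merge I V (y, x)) = (\<Prod>v\<in>V. f y (x v)) * (\<Prod>e\<in>E. edge_val W x e)" for x y
  proof -
    have "edge_val W (merge I V (y, x)) e = edge_val W x e" if "e \<in> E" for e
    proof -
      obtain a b where "e = {a, b}" "a \<in> V" "b \<in> V" by (rule leafwise_edge[OF E \<open>e \<in> E\<close>])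
      with fin(4) show ?thesis by (auto simp: edge_val_pair merge_def)
    qed
    moreover have "(\<Prod>v\<in>V. \<Prod>j\<in>I. W (merge I V (y, x) v) (merge I V (y, x) j)) = (\<Prod>v\<in>V. f y (x v))"
      unfolding f_def using fin(4) by (intro prod.cong refl) (auto simp: merge_def)
    ultimately show ?thesis unfolding D_def by (simp cong: prod.cong)
  qed
  have m_comp: "(\<lambda>z. g z j) \<in> measurable R M" if "g \<in> measurable R N" "j \<in> I" for g j and R :: "'z measure"
    using that unfolding N_def by (intro measurable_compose[OF that(1)[unfolded N_def] measurable_component_singleton])
  have bf: "pos_bdd R (\<lambda>z. f (g z) (h z))" if "g \<in> measurable R N" "h \<in> measurable R M" for g h and R :: "'z measure"
    unfolding f_def using that fin(1) by (intro pos_bdd_prod pos_bdd_W_compose m_comp[of g]) auto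
  have wk: "weighted_kernel M W (f y)" if "y \<in> space N" for y
    using that by unfold_locales (intro bf, auto)
  have bF: "pos_bdd (N \<Otimes>\<^sub>M M) (\<lambda>(y, x). f y x)"
    unfolding case_prod_unfold by (intro bf measurable_fst measurable_snd)
  have bH: "pos_bdd ((N \<Otimes>\<^sub>M M) \<Otimes>\<^sub>M M) (\<lambda>((y, x), x'). f y x * (W x x' * f y x'))"
    unfolding case_prod_unfold
    by (intro pos_bdd_mult bf pos_bdd_W_compose measurable_snd measurable_compose[OF measurable_fst measurable_fst]
        measurable_compose[OF measurable_fst measurable_snd])
  have bH': "pos_bdd (N \<Otimes>\<^sub>M M) (\<lambda>(y, x). f y x * (\<integral>x'. W x x' * f y x' \<partial>M))"
    using pos_bdd_integral_param[of _ "\<lambda>(y, x) x'. f y x * (W x x' * f y x')"] bH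
    by (simp add: case_prod_unfold)
  \<comment> \<open>For fixed \<open>x\<close> the \<open>k\<close> apex coordinates are
    independent, each contributing a factor \<open>deg x\<close>.\<close>
  have F_int: "(\<integral>y. F y \<partial>N) = star_density k"
  proof -
    have "(\<integral>y. F y \<partial>N) = (\<integral>x. (\<integral>y. f y x \<partial>N) \<partial>M)"
      unfolding F_def by (rule pos_bdd_Fubini[OF N.prob_space_axioms prob_space_axioms bF])
    also have "\<dots> = star_density k"
      unfolding star_density_def
    proof (intro Bochner_Integration.integral_cong refl)
      fix x assume x: "x \<in> space M"
      have "(\<integral>y. f y x \<partial>N) = (\<Prod>j\<in>I. \<integral>y. W x y \<partial>M)"
        unfolding f_def N_def using fin(1) x
        by (intro P.product_integral_prod pos_bdd_integrable pos_bdd_W_compose) auto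
      then show "(\<integral>y. f y x \<partial>N) = deg x ^ k" by (simp add: deg_def cardI)
    qed
    finally show ?thesis .
  qed
  \<comment> \<open>For fixed \<open>x\<close> and \<open>x'\<close> each apex coordinate
    contributes a factor \<open>codeg x x'\<close>.\<close>
  have H_int: "(\<integral>y. H y \<partial>N) = book_density k"
  proof -
    have "(\<integral>y. H y \<partial>N) = (\<integral>x. (\<integral>y. f y x * (\<integral>x'. W x x' * f y x' \<partial>M) \<partial>N) \<partial>M)"
      unfolding H_def by (rule pos_bdd_Fubini[OF N.prob_space_axioms prob_space_axioms bH'])
    also have "\<dots> = book_density k"
      unfolding book_density_def
    proof (intro Bochner_Integration.integral_cong refl)
      fix x assume x: "x \<in> space M"
      have b: "pos_bdd (N \<Otimes>\<^sub>M M) (\<lambda>(y, x'). f y x * (W x x' * f y x'))"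
        unfolding case_prod_unfold using x
        by (intro pos_bdd_mult bf pos_bdd_W_compose measurable_fst measurable_snd measurable_const)
      have "(\<integral>y. f y x * (\<integral>x'. W x x' * f y x' \<partial>M) \<partial>N) = (\<integral>y. (\<integral>x'. f y x * (W x x' * f y x') \<partial>M) \<partial>N)"
        by simp
      also have "\<dots> = (\<integral>x'. (\<integral>y. f y x * (W x x' * f y x') \<partial>N) \<partial>M)"
        by (rule pos_bdd_Fubini[OF N.prob_space_axioms prob_space_axioms b])
      also have "\<dots> = (\<integral>x'. W x x' * codeg x x' ^ k \<partial>M)"
      proof (intro Bochner_Integration.integral_cong refl)
        fix x' assume x': "x' \<in> space M"
        have "(\<integral>y. f y x * (W x x' * f y x') \<partial>N) = (\<integral>y. W x x' * (\<Prod>j\<in>I. W x (y j) * W x' (y j)) \<partial>N)"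
          by (simp add: f_def prod.distrib mult_ac)
        also have "\<dots> = W x x' * (\<integral>y. (\<Prod>j\<in>I. W x (y j) * W x' (y j)) \<partial>N)"
          by simp
        also have "(\<integral>y. (\<Prod>j\<in>I. W x (y j) * W x' (y j)) \<partial>N) = (\<Prod>j\<in>I. \<integral>y. W x y * W x' y \<partial>M)"
          unfolding N_def using fin(1) x x'
          by (intro P.product_integral_prod[where f = "\<lambda>_ y. W x y * W x' y"] pos_bdd_integrable pos_bdd_mult pos_bdd_W_compose) auto
        finally show "(\<integral>y. f y x * (W x x' * f y x') \<partial>N) = W x x' * codeg x x' ^ k"
          by (simp add: codeg_def cardI)
      qed
      finally show "(\<integral>y. f y x * (\<integral>x'. W x x' * f y x' \<partial>M) \<partial>N) = (\<integral>x'. W x x' * codeg x x' ^ k \<partial>M)" .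
    qed
    finally show ?thesis .
  qed
  interpret VV: prob_space "PiM V (\<lambda>_. M)" by (intro prob_space_PiM prob_space_axioms)
  interpret IV: prob_space "PiM (I \<union> V) (\<lambda>_. M)" by (intro prob_space_PiM prob_space_axioms)
  have iF: "integrable N F" and iH: "integrable N H"
    unfolding F_def H_def using bF bH' by (auto intro!: N.pos_bdd_integrable pos_bdd_integral_param)
  \<comment> \<open>The bound for fixed \<open>y\<close> is linear in \<open>F y\<close> and
    \<open>H y\<close>, so its average involves only their integrals.\<close>
  have "l ^ m * (star_density k + real m * (book_density k / l - star_density k))
      = (\<integral>y. l ^ m * (F y + real m * (H y / l - F y)) \<partial>N)"
    using iF iH by (simp add: F_int H_int)
  also have "\<dots> \<le> (\<integral>y. (\<integral>x. D (merge I V (y, x)) \<partial>PiM V (\<lambda>_. M)) \<partial>N)"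
  proof (rule integral_mono)
    show "integrable N (\<lambda>y. l ^ m * (F y + real m * (H y / l - F y)))"
      using iF iH by simp
    show "integrable N (\<lambda>y. \<integral>x. D (merge I V (y, x)) \<partial>PiM V (\<lambda>_. M))"
      using pos_bdd_compose[OF bD measurable_merge]
      by (intro N.pos_bdd_integrable VV.pos_bdd_integral_param) (simp add: N_def case_prod_unfold)
    show "l ^ m * (F y + real m * (H y / l - F y)) \<le> (\<integral>x. D (merge I V (y, x)) \<partial>PiM V (\<lambda>_. M))"
      if "y \<in> space N" for y
    proof -
      interpret weighted_kernel M W "f y" using wk[OF that] .
      show ?thesis
        using leafwise_integral_ge[OF E l]
        by (simp add: D_merge cardE mass_def edge_mass_def wdeg_def F_def H_def)
    qed
  qed
  also have "\<dots> = (\<integral>x. D x \<partial>PiM (I \<union> V) (\<lambda>_. M))"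
    unfolding N_def using fin by (intro P.product_integral_fold[symmetric] IV.pos_bdd_integrable bD)
  finally show ?thesis by (simp add: verts D m_def)
qed

lemma pos_bdd_deg: "pos_bdd M deg"
  unfolding deg_def using pos_bdd_W by (rule pos_bdd_integral_param)

lemma pos_bdd_codeg: "pos_bdd (M \<Otimes>\<^sub>M M) (\<lambda>(x, y). codeg x y)"
proof -
  have "pos_bdd ((M \<Otimes>\<^sub>M M) \<Otimes>\<^sub>M M) (\<lambda>z. W (fst (fst z)) (snd z) * W (snd (fst z)) (snd z))"
    by (intro pos_bdd_mult pos_bdd_W_compose measurable_snd measurable_compose[OF measurable_fst measurable_fst]
        measurable_compose[OF measurable_fst measurable_snd])
  then show ?thesis
    using pos_bdd_integral_param[of _ "\<lambda>(x, y) z. W x z * W y z"]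
    by (simp add: case_prod_unfold codeg_def)
qed

lemma pos_bdd_codeg_compose:
  assumes "g \<in> measurable N M" "h \<in> measurable N M"
  shows "pos_bdd N (\<lambda>z. codeg (g z) (h z))"
  using pos_bdd_compose[OF pos_bdd_codeg measurable_Pair[OF assms]] by simp

lemma pos_bdd_power: "pos_bdd N g \<Longrightarrow> pos_bdd N (\<lambda>x. g x ^ k)"
  using pos_bdd_prod[of "{..<k}" N "\<lambda>_. g"] by simp

lemma pos_bdd_integrable_fst:
  assumes "pos_bdd (M \<Otimes>\<^sub>M M) (\<lambda>(x, y). F x y)"
  shows "integrable M (\<lambda>x. \<integral>y. F x y \<partial>M)"
  using assms by (intro pos_bdd_integrable pos_bdd_integral_param)

text \<open>Both sides are the density of the path with two edges, rooted at an end and at the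
  midpoint.\<close>

lemma integral_W_deg:
  "(\<integral>x. (\<integral>y. W x y * deg y \<partial>M) \<partial>M) = (\<integral>x. (deg x)\<^sup>2 \<partial>M)"
proof -
  have "pos_bdd (M \<Otimes>\<^sub>M M) (\<lambda>(x, y). W x y * deg y)"
    unfolding case_prod_unfold
    by (intro pos_bdd_mult pos_bdd_W_compose pos_bdd_compose[OF pos_bdd_deg measurable_snd] measurable_fst measurable_snd)
  from pos_bdd_Fubini[OF prob_space_axioms prob_space_axioms this]
  have "(\<integral>x. (\<integral>y. W x y * deg y \<partial>M) \<partial>M) = (\<integral>y. (\<integral>x. W y x * deg y \<partial>M) \<partial>M)"
    by (simp only: W_sym)
  then show ?thesis by (simp add: deg_def power2_eq_square)
qed

text \<open>Both sides measure the walks of length two that start at \<open>x\<close>.\<close>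

lemma integral_codeg:
  assumes x: "x \<in> space M"
  shows "(\<integral>y. codeg x y \<partial>M) = (\<integral>y. W x y * deg y \<partial>M)"
proof -
  have "pos_bdd (M \<Otimes>\<^sub>M M) (\<lambda>(y, z). W x z * W y z)"
    unfolding case_prod_unfold using x
    by (intro pos_bdd_mult pos_bdd_W_compose measurable_fst measurable_snd measurable_const)
  from pos_bdd_Fubini[OF prob_space_axioms prob_space_axioms this]
  have "(\<integral>y. codeg x y \<partial>M) = (\<integral>z. (\<integral>y. W x z * W z y \<partial>M) \<partial>M)"
    unfolding codeg_def by (simp only: W_sym)
  then show ?thesis by (simp add: deg_def)
qed

text \<open>\<open>star_density 1\<close> and \<open>book_density 1\<close> are the edge and triangle densities.\<close>

lemma book_density_ge:
  assumes t: "0 < t"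
  shows "t ^ k * (star_density 1 + real k * (book_density 1 / t - star_density 1)) \<le> book_density k"
proof -
  have b: "pos_bdd (M \<Otimes>\<^sub>M M) (\<lambda>(x, y). W x y * codeg x y ^ j)" for j
    unfolding case_prod_unfold
    by (intro pos_bdd_mult pos_bdd_power pos_bdd_W_compose pos_bdd_codeg_compose measurable_fst measurable_snd)
  have bx: "pos_bdd M (\<lambda>y. W x y * codeg x y ^ j)" if "x \<in> space M" for x j
    using that by (intro pos_bdd_mult pos_bdd_power pos_bdd_W_compose pos_bdd_codeg_compose) auto
  have b0: "integrable M (\<lambda>x. deg x)" "integrable M (\<lambda>y. W x y)" if "x \<in> space M" for x
    using that by (auto intro!: pos_bdd_integrable pos_bdd_W_compose pos_bdd_deg)
  have b1: "integrable M (\<lambda>x. \<integral>y. W x y * codeg x y \<partial>M)"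
    using pos_bdd_integrable_fst[OF b[of 1]] by simp
  have "t ^ k * (star_density 1 + real k * (book_density 1 / t - star_density 1))
      = (\<integral>x. t ^ k * (deg x + real k * ((\<integral>y. W x y * codeg x y \<partial>M) / t - deg x)) \<partial>M)"
    using b1 pos_bdd_integrable[OF pos_bdd_deg] by (simp add: star_density_def book_density_def)
  also have "\<dots> \<le> book_density k"
    unfolding book_density_def
  proof (rule integral_mono)
    show "integrable M (\<lambda>x. t ^ k * (deg x + real k * ((\<integral>y. W x y * codeg x y \<partial>M) / t - deg x)))"
      using b1 pos_bdd_integrable[OF pos_bdd_deg] by simp
    show "integrable M (\<lambda>x. \<integral>y. W x y * codeg x y ^ k \<partial>M)"
      using b by (rule pos_bdd_integrable_fst)
    fix x assume x: "x \<in> space M"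
    have i: "integrable M (\<lambda>y. W x y)" "integrable M (\<lambda>y. W x y * codeg x y)"
      using b0[OF x] pos_bdd_integrable[OF bx[OF x, of 1]] by simp_all
    have "t ^ k * (deg x + real k * ((\<integral>y. W x y * codeg x y \<partial>M) / t - deg x))
        = (\<integral>y. t ^ k * (W x y + real k * (W x y * codeg x y / t - W x y)) \<partial>M)"
      using i by (simp add: deg_def)
    also have "\<dots> \<le> (\<integral>y. W x y * codeg x y ^ k \<partial>M)"
    proof (rule integral_mono)
      show "integrable M (\<lambda>y. t ^ k * (W x y + real k * (W x y * codeg x y / t - W x y)))"
        using i by simp
      show "integrable M (\<lambda>y. W x y * codeg x y ^ k)"
        using bx[OF x] by (rule pos_bdd_integrable)
      fix y assume y: "y \<in> space M"
      have "0 < codeg x y" "0 < W x y"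
        using pos_bdd_pos[OF pos_bdd_codeg, of "(x, y)"] pos_bdd_pos[OF pos_bdd_W, of "(x, y)"] x y
        by (auto simp: space_pair_measure)
      \<comment> \<open>The tangent bound at \<open>t\<close> for the power of the codegree,
        weighted by the edge.\<close>
      then have "W x y * (t ^ k * (1 + real k * (codeg x y / t - 1))) \<le> W x y * codeg x y ^ k"
        using power_ge_tangent[OF _ t] by (intro mult_left_mono) auto
      then show "t ^ k * (W x y + real k * (W x y * codeg x y / t - W x y)) \<le> W x y * codeg x y ^ k"
        by (simp add: algebra_simps)
    qed
    finally show "t ^ k * (deg x + real k * ((\<integral>y. W x y * codeg x y \<partial>M) / t - deg x))
      \<le> (\<integral>y. W x y * codeg x y ^ k \<partial>M)" .
  qed
  finally show ?thesis .
qed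

end

section \<open>Both colours together: Goodman's formula and the comparison of books with
  stars\<close>

locale complementary_kernels = sym_kernel + compl: sym_kernel M "\<lambda>x y. 1 - W x y"
begin

lemma integrable_W: "x \<in> space M \<Longrightarrow> integrable M (\<lambda>y. W x y)"
  by (intro pos_bdd_integrable pos_bdd_W_compose) auto

lemma compl_deg: "x \<in> space M \<Longrightarrow> compl.deg x = 1 - deg x"
  unfolding compl.deg_def deg_def using integrable_W by (simp add: prob_space)

lemma compl_codeg:
  assumes "x \<in> space M" "y \<in> space M"
  shows "compl.codeg x y = 1 - deg x - deg y + codeg x y"
proof -
  have "integrable M (\<lambda>z. W x z * W y z)"
    using assms by (intro pos_bdd_integrable pos_bdd_mult pos_bdd_W_compose) auto
  moreover have "compl.codeg x y = (\<integral>z. 1 - W x z - W y z + W x z * W y z \<partial>M)"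
    unfolding compl.codeg_def by (simp add: algebra_simps)
  ultimately show ?thesis
    using integrable_W assms by (simp add: deg_def codeg_def prob_space)
qed

text \<open>Goodman's formula: the monochromatic triangle density depends on the degrees alone,
  since the triangle terms of the two colours cancel.\<close>

lemma triangle_densities:
  "book_density 1 + compl.book_density 1 = 1 - 3 * star_density 1 + 3 * star_density 2"
proof -
  have inner: "(\<integral>y. W x y * codeg x y \<partial>M) + (\<integral>y. (1 - W x y) * compl.codeg x y \<partial>M)
      = 1 - 2 * deg x - star_density 1 + 2 * (\<integral>y. W x y * deg y \<partial>M) + (deg x)\<^sup>2" (is "?l = _")
    if x: "x \<in> space M" for x
  proof -
    have i: "integrable M (\<lambda>y. W x y)" "integrable M (\<lambda>y. W x y * codeg x y)" "integrable M deg"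
      "integrable M (\<lambda>y. (1 - W x y) * compl.codeg x y)" "integrable M (\<lambda>y. W x y * deg y)" "integrable M (codeg x)"
      using x by (auto intro!: pos_bdd_integrable pos_bdd_mult pos_bdd_W_compose pos_bdd_codeg_compose pos_bdd_deg
          compl.pos_bdd_W_compose compl.pos_bdd_codeg_compose)
    have "?l = (\<integral>y. W x y * codeg x y + (1 - W x y) * compl.codeg x y \<partial>M)"
      using i by simp
    \<comment> \<open>Expanding \<open>compl.codeg\<close> produces
      \<open>- W x y * codeg x y\<close>, which cancels the first summand.\<close>
    also have "\<dots> = (\<integral>y. (1 - deg x) - deg y + codeg x y - (1 - deg x) * W x y + W x y * deg y \<partial>M)"
      using x by (intro Bochner_Integration.integral_cong refl) (simp add: compl_codeg algebra_simps)
    also have "\<dots> = (1 - deg x) - star_density 1 + (\<integral>y. codeg x y \<partial>M) - (1 - deg x) * deg x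
        + (\<integral>y. W x y * deg y \<partial>M)"
      using i by (simp add: star_density_def prob_space deg_def[of x])
    finally show ?thesis
      using integral_codeg[OF x] by (simp add: algebra_simps power2_eq_square)
  qed
  have "pos_bdd (M \<Otimes>\<^sub>M M) (\<lambda>(x, y). W x y * deg y)" "pos_bdd (M \<Otimes>\<^sub>M M) (\<lambda>(x, y). W x y * codeg x y)"
    "pos_bdd (M \<Otimes>\<^sub>M M) (\<lambda>(x, y). (1 - W x y) * compl.codeg x y)"
    unfolding case_prod_unfold
    by (intro pos_bdd_mult pos_bdd_W_compose pos_bdd_codeg_compose pos_bdd_compose[OF pos_bdd_deg measurable_snd]
        compl.pos_bdd_W_compose compl.pos_bdd_codeg_compose measurable_fst measurable_snd)+
  note i = this[THEN pos_bdd_integrable_fst] pos_bdd_integrable[OF pos_bdd_deg]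
    pos_bdd_integrable[OF pos_bdd_power[OF pos_bdd_deg, of 2]]
  have "book_density 1 + compl.book_density 1
      = (\<integral>x. (\<integral>y. W x y * codeg x y \<partial>M) + (\<integral>y. (1 - W x y) * compl.codeg x y \<partial>M) \<partial>M)"
    unfolding book_density_def compl.book_density_def using i by simp
  also have "\<dots> = (\<integral>x. 1 - 2 * deg x - star_density 1 + 2 * (\<integral>y. W x y * deg y \<partial>M) + (deg x)\<^sup>2 \<partial>M)"
    using inner by (intro Bochner_Integration.integral_cong refl) simp
  also have "\<dots> = 1 - 3 * star_density 1 + 3 * star_density 2"
    using i by (simp add: prob_space integral_W_deg) (simp add: star_density_def)
  finally show ?thesis .
qed

lemma star_densities:
  "star_density k + compl.star_density k = (\<integral>x. deg x ^ k + (1 - deg x) ^ k \<partial>M)"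
proof -
  have i: "integrable M (\<lambda>x. deg x ^ k)" "integrable M (\<lambda>x. compl.deg x ^ k)"
    by (intro pos_bdd_integrable pos_bdd_power pos_bdd_deg compl.pos_bdd_deg)+
  have "star_density k + compl.star_density k = (\<integral>x. deg x ^ k + compl.deg x ^ k \<partial>M)"
    unfolding star_density_def compl.star_density_def using i by simp
  also have "\<dots> = (\<integral>x. deg x ^ k + (1 - deg x) ^ k \<partial>M)"
    by (intro Bochner_Integration.integral_cong refl) (simp add: compl_deg)
  finally show ?thesis .
qed

lemma deg_bounds: "x \<in> space M \<Longrightarrow> 0 < deg x \<and> deg x < 1"
  using pos_bdd_pos[OF pos_bdd_deg] pos_bdd_pos[OF compl.pos_bdd_deg] compl_deg by force

lemma integrable_star: "integrable M (\<lambda>x. deg x ^ k + (1 - deg x) ^ k)"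
proof -
  have "integrable M (\<lambda>x. compl.deg x ^ k)"
    by (intro pos_bdd_integrable pos_bdd_power compl.pos_bdd_deg)
  then have "integrable M (\<lambda>x. (1 - deg x) ^ k)"
    by (simp add: compl_deg cong: Bochner_Integration.integrable_cong)
  then show ?thesis
    using pos_bdd_integrable[OF pos_bdd_power[OF pos_bdd_deg, of k]] by simp
qed

text \<open>The tangents at 1/2 for \<open>deg x\<close> and \<open>1 - deg x\<close> have opposite
  slopes as functions of \<open>deg x\<close>, so their sum is constant.\<close>

lemma star_densities_ge: "2 * (1/2) ^ k \<le> star_density k + compl.star_density k"
  unfolding star_densities
proof (rule integral_ge_const)
  have "2 * (1/2) ^ k \<le> deg x ^ k + (1 - deg x) ^ k" if "x \<in> space M" for x
    using power_ge_tangent[of "deg x" "1/2" k] power_ge_tangent[of "1 - deg x" "1/2" k] deg_bounds[OF that]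
    by (simp add: algebra_simps)
  then show "AE x in M. 2 * (1/2) ^ k \<le> deg x ^ k + (1 - deg x) ^ k" by (rule AE_I2)
qed (rule integrable_star)

lemma star_densities_le:
  assumes "k \<in> {1, 2, 3, 4, 5}"
  shows "star_density k + compl.star_density k
    \<le> 2 * (1/2) ^ k * (1 + 3 * real k * (4 * star_density 2 - 4 * star_density 1 + 1))"
proof -
  have i: "integrable M deg" "integrable M (\<lambda>x. (deg x)\<^sup>2)"
    by (intro pos_bdd_integrable pos_bdd_power pos_bdd_deg)+
  have "(\<integral>x. deg x ^ k + (1 - deg x) ^ k \<partial>M)
      \<le> (\<integral>x. 2 * (1/2) ^ k * (1 + 3 * real k * (4 * (deg x)\<^sup>2 - 4 * deg x + 1)) \<partial>M)"
  proof (rule integral_mono[OF integrable_star])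
    show "integrable M (\<lambda>x. 2 * (1/2) ^ k * (1 + 3 * real k * (4 * (deg x)\<^sup>2 - 4 * deg x + 1)))"
      using i by simp
    fix x assume "x \<in> space M"
    then have "0 \<le> deg x" "deg x \<le> 1" using deg_bounds[of x] by auto
    with symmetric_power_sum_le[OF assms this]
    show "deg x ^ k + (1 - deg x) ^ k \<le> 2 * (1/2) ^ k * (1 + 3 * real k * (4 * (deg x)\<^sup>2 - 4 * deg x + 1))"
      by simp
  qed
  also have "\<dots> = 2 * (1/2) ^ k * (1 + 3 * real k * (4 * star_density 2 - 4 * star_density 1 + 1))"
    using i by (simp add: prob_space star_density_def)
  finally show ?thesis unfolding star_densities .
qed

lemma star_density_sum_1: "star_density 1 + compl.star_density 1 = 1"
  unfolding star_densities by (simp add: prob_space)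

text \<open>The tangent point in \<open>book_density_ge\<close> is the total monochromatic triangle
  density \<open>t\<close>, the same for both colours. With it the two tangent bounds add up to
  exactly \<open>t ^ k\<close>, because the edge densities sum to 1 and the triangle densities to
  \<open>t\<close>.\<close>

lemma book_densities_ge:
  assumes k: "k \<in> {1, 2, 3, 4, 5}"
  shows "(1/2) ^ Suc k * (star_density k + compl.star_density k) \<le> book_density k + compl.book_density k"
proof -
  define t where "t = book_density 1 + compl.book_density 1"
  define u where "u = 4 * star_density 2 - 4 * star_density 1 + 1"
  have i: "integrable M deg" "integrable M (\<lambda>x. (deg x)\<^sup>2)"
    by (intro pos_bdd_integrable pos_bdd_power pos_bdd_deg)+
  have "u = (\<integral>x. (2 * deg x - 1)\<^sup>2 \<partial>M)"
    using i by (simp add: u_def star_density_def power2_diff power_mult_distrib prob_space)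
  then have u: "0 \<le> u" by simp
  \<comment> \<open>Goodman's formula rewritten with \<open>u\<close>, the variance of the degrees
    around 1/2 up to a factor of 4.\<close>
  have t: "t = (1/4) * (1 + 3 * u)"
    unfolding t_def triangle_densities u_def by simp
  have "0 < t" using t u by simp
  have "(1/2) ^ Suc k * (star_density k + compl.star_density k)
      \<le> (1/2) ^ Suc k * (2 * (1/2) ^ k * (1 + 3 * real k * u))"
    using star_densities_le[OF k] unfolding u_def by (intro mult_left_mono) auto
  also have "\<dots> = (1/4) ^ k * (1 + real k * (3 * u))"
  proof -
    have "(1/4 :: real) ^ k = (1/2) ^ k * (1/2) ^ k" by (simp flip: power_mult_distrib)
    then show ?thesis by (simp add: mult.assoc)
  qed
  also have "\<dots> \<le> (1/4) ^ k * (1 + 3 * u) ^ k"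
    using u Bernoulli_inequality[of "3 * u" k] by (intro mult_left_mono) auto
  also have "\<dots> = t ^ k" unfolding t by (simp only: power_mult_distrib)
  also have "\<dots> = t ^ k * (star_density 1 + real k * (book_density 1 / t - star_density 1))
      + t ^ k * (compl.star_density 1 + real k * (compl.book_density 1 / t - compl.star_density 1))"
  proof -
    have "(star_density 1 + real k * (book_density 1 / t - star_density 1))
        + (compl.star_density 1 + real k * (compl.book_density 1 / t - compl.star_density 1))
      = (star_density 1 + compl.star_density 1) * (1 - real k)
        + real k * ((book_density 1 + compl.book_density 1) / t)"
      by (simp add: algebra_simps add_divide_distrib)
    also have "\<dots> = 1"
      using \<open>0 < t\<close> unfolding star_density_sum_1 t_def by simp
    finally show ?thesis by (simp only: distrib_left[symmetric] mult_1_right)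
  qed
  also have "\<dots> \<le> book_density k + compl.book_density k"
    by (intro add_mono book_density_ge compl.book_density_ge \<open>0 < t\<close>)
  finally show ?thesis .
qed

text \<open>The tree bounds for the two colours are added. Their sum depends only on the total star
  and book densities, which \<open>star_densities_ge\<close> and \<open>book_densities_ge\<close>
  control.\<close>

lemma apex_mono_ge:
  fixes G :: "'c graph"
  assumes VE: "leafwise (verts G) (edges G)" and k: "k \<in> {1, 2, 3, 4, 5}"
  shows "2 * (1/2) ^ (card (edges G) * Suc k + k) \<le>
    (\<integral>x. (\<Prod>e\<in>edges (apex k G). edge_val W x e) \<partial>PiM (verts (apex k G)) (\<lambda>_. M)) +
    (\<integral>x. (\<Prod>e\<in>edges (apex k G). edge_val (\<lambda>x y. 1 - W x y) x e) \<partial>PiM (verts (apex k G)) (\<lambda>_. M))"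
proof -
  \<comment> \<open>The ratio of \<open>edge_mass\<close> to \<open>mass\<close> for the constant
    kernel 1/2, where equality has to hold.\<close>
  define l :: real where "l = (1/2) ^ Suc k"
  define m where "m = card (edges G)"
  define A where "A = book_density k + compl.book_density k"
  define B where "B = star_density k + compl.star_density k"
  have l: "0 < l" by (simp add: l_def)
  have "l * B \<le> A" using book_densities_ge[OF k] by (simp add: A_def B_def l_def)
  then have AB: "0 \<le> A / l - B" using l by (simp add: field_simps)
  have "2 * (1/2) ^ (m * Suc k + k) = l ^ m * (2 * (1/2) ^ k)"
  proof -
    have "l ^ m = (1/2) ^ (m * Suc k)" unfolding l_def by (metis mult.commute power_mult)
    then show ?thesis by (simp only: power_add mult_ac)
  qed
  \<comment> \<open>The term with factor \<open>m\<close> is nonnegative by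
    \<open>AB\<close>.\<close>
  also have "\<dots> \<le> l ^ m * (B + real m * (A / l - B))"
    using star_densities_ge[of k] AB l by (intro mult_left_mono) (auto simp: B_def add_increasing2)
  also have "\<dots> = l ^ m * (star_density k + real m * (book_density k / l - star_density k))
      + l ^ m * (compl.star_density k + real m * (compl.book_density k / l - compl.star_density k))"
    by (simp add: A_def B_def algebra_simps add_divide_distrib)
  also have "\<dots> \<le> (\<integral>x. (\<Prod>e\<in>edges (apex k G). edge_val W x e) \<partial>PiM (verts (apex k G)) (\<lambda>_. M)) +
    (\<integral>x. (\<Prod>e\<in>edges (apex k G). edge_val (\<lambda>x y. 1 - W x y) x e) \<partial>PiM (verts (apex k G)) (\<lambda>_. M))"
    unfolding m_def by (intro add_mono apex_integral_ge compl.apex_integral_ge VE l)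
  finally show ?thesis unfolding m_def .
qed

end

subsection \<open>From graphons to kernels bounded away from 0 and 1\<close>

abbreviation unit_measure :: "real measure" where
  "unit_measure \<equiv> restrict_space lborel {0..1}"

lemma prob_space_unit_measure: "prob_space unit_measure"
  by (rule prob_space_restrict_space) auto

text \<open>Distinct coordinates are independent. This carries almost-everywhere statements about
  pairs over to the two ends of an edge.\<close>

lemma (in prob_space) distr_PiM_pair:
  assumes "u \<in> V" "v \<in> V" "u \<noteq> v"
  shows "distr (PiM V (\<lambda>_. M)) (M \<Otimes>\<^sub>M M) (\<lambda>x. (x u, x v)) = M \<Otimes>\<^sub>M M"
proof (rule sym, rule pair_measure_eqI)
  interpret P: product_prob_space "\<lambda>_. M" V ..
  have m: "(\<lambda>x. (x u, x v)) \<in> measurable (PiM V (\<lambda>_. M)) (M \<Otimes>\<^sub>M M)"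
    using assms by (intro measurable_Pair measurable_component_singleton)
  fix A B assume AB: "A \<in> sets M" "B \<in> sets M"
  have "emeasure (distr (PiM V (\<lambda>_. M)) (M \<Otimes>\<^sub>M M) (\<lambda>x. (x u, x v))) (A \<times> B)
      = emeasure (PiM V (\<lambda>_. M)) ((\<lambda>x. (x u, x v)) -` (A \<times> B) \<inter> space (PiM V (\<lambda>_. M)))"
    using AB by (intro emeasure_distr[OF m]) auto
  also have "(\<lambda>x. (x u, x v)) -` (A \<times> B) \<inter> space (PiM V (\<lambda>_. M))
      = {x \<in> space (PiM V (\<lambda>_. M)). \<forall>i\<in>{u, v}. x i \<in> (if i = u then A else B)}"
    using assms(3) by auto
  also have "emeasure (PiM V (\<lambda>_. M)) \<dots> = (\<Prod>i\<in>{u, v}. emeasure M (if i = u then A else B))"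
    using assms AB by (intro P.emeasure_PiM_Collect) auto
  also have "\<dots> = emeasure M A * emeasure M B" using assms(3) by simp
  finally show "emeasure M A * emeasure M B
      = emeasure (distr (PiM V (\<lambda>_. M)) (M \<Otimes>\<^sub>M M) (\<lambda>x. (x u, x v))) (A \<times> B)" by simp
qed (auto simp: sigma_finite_measure_axioms)

text \<open>A preimage under \<open>g\<close> differs from one under \<open>f\<close> only inside a
  null set, all of whose subsets are measurable in the completion.\<close>

lemma borel_measurable_completion_AE:
  assumes f: "f \<in> borel_measurable M" and ae: "AE x in M. f x = g x"
  shows "g \<in> borel_measurable (completion M)"
proof (rule measurableI)
  obtain N where N: "N \<in> null_sets M" "{x \<in> space M. f x \<noteq> g x} \<subseteq> N"
    by (rule AE_E[OF ae]) (auto simp: null_sets_def)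
  fix A :: "'b set" assume A: "A \<in> sets borel"
  have eq: "g -` A \<inter> space M = ((f -` A \<inter> space M) - N) \<union> (g -` A \<inter> space M \<inter> N)"
    using N(2) by auto
  have s: "(f -` A \<inter> space M) - N \<in> sets M"
    using measurable_sets[OF f A] N(1) by auto
  show "g -` A \<inter> space (completion M) \<in> sets (completion M)"
    unfolding space_completion by (rule sets_completionI[OF eq Int_lower2 N(1) s])
qed auto

lemma integral_completion_AE:
  fixes f g :: "'b \<Rightarrow> real"
  assumes "f \<in> borel_measurable M" and "AE x in M. f x = g x"
  shows "integral\<^sup>L (completion M) g = integral\<^sup>L M f"
proof -
  have "integral\<^sup>L (completion M) g = integral\<^sup>L (completion M) f"
    using assms AE_completion[OF assms(2)]
    by (intro integral_cong_AE borel_measurable_completion_AE measurable_completion) auto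
  then show ?thesis using assms(1) by (simp add: integral_completion)
qed

lemma edge_ends_edge:
  assumes "simple_graph H" "e \<in> edges H"
  obtains u v where "edge_ends e = (u, v)" "u \<in> verts H" "v \<in> verts H" "u \<noteq> v"
proof -
  have "e \<subseteq> verts H" "card e = 2" using assms by (auto simp: simple_graph_def)
  then obtain a b where e: "e = {a, b}" "a \<noteq> b" "a \<in> verts H" "b \<in> verts H"
    by (auto simp: card_2_iff)
  obtain u v where uv: "edge_ends e = (u, v)" by (cases "edge_ends e")
  have "case edge_ends e of (u, v) \<Rightarrow> e = {u, v}"
    unfolding edge_ends_def by (rule someI[where x = "(a, b)"]) (simp add: e(1))
  then have "{a, b} = {u, v}" using uv e by simp
  with e have "u \<in> verts H" "v \<in> verts H" "u \<noteq> v" by (auto simp: doubleton_eq_iff)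
  with uv show thesis by (rule that)
qed

lemma hom_integrand_measurable:
  assumes W: "(\<lambda>(x, y). W x y) \<in> borel_measurable (M \<Otimes>\<^sub>M M)" and H: "simple_graph H"
  shows "(\<lambda>x. \<Prod>e\<in>edges H. edge_val W x e) \<in> borel_measurable (PiM (verts H) (\<lambda>_. M))"
proof (rule borel_measurable_prod)
  fix e assume "e \<in> edges H"
  then obtain u v where e: "edge_ends e = (u, v)" "u \<in> verts H" "v \<in> verts H"
    using edge_ends_edge[OF H] by metis
  have "(\<lambda>x. (x u, x v)) \<in> measurable (PiM (verts H) (\<lambda>_. M)) (M \<Otimes>\<^sub>M M)"
    using e by (intro measurable_Pair measurable_component_singleton)
  from measurable_compose[OF this W]
  show "(\<lambda>x. edge_val W x e) \<in> borel_measurable (PiM (verts H) (\<lambda>_. M))"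
    by (simp add: edge_val_def e)
qed

text \<open>The exceptional null set of pairs pulls back to a null set along each edge, and there
  are finitely many edges. This also removes the completion from \<open>hom_density\<close>.\<close>

lemma hom_density_AE_eq:
  assumes H: "simple_graph H" and W': "(\<lambda>(x, y). W' x y) \<in> borel_measurable (unit_measure \<Otimes>\<^sub>M unit_measure)"
    and ae: "AE (x, y) in unit_measure \<Otimes>\<^sub>M unit_measure. W' x y = W x y"
  shows "hom_density H W = (\<integral>x. (\<Prod>e\<in>edges H. edge_val W' x e) \<partial>PiM (verts H) (\<lambda>_. unit_measure))"
proof -
  interpret prob_space unit_measure by (rule prob_space_unit_measure)
  have fin: "finite (edges H)"
    using H by (auto simp: simple_graph_def intro: finite_subset[of _ "Pow (verts H)"])
  have "AE x in PiM (verts H) (\<lambda>_. unit_measure). edge_val W' x e = edge_val W x e" if "e \<in> edges H" for e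
  proof -
    obtain u v where e: "edge_ends e = (u, v)" "u \<in> verts H" "v \<in> verts H" "u \<noteq> v"
      by (rule edge_ends_edge[OF H \<open>e \<in> edges H\<close>])
    have m: "(\<lambda>x. (x u, x v)) \<in> measurable (PiM (verts H) (\<lambda>_. unit_measure)) (unit_measure \<Otimes>\<^sub>M unit_measure)"
      using e by (intro measurable_Pair measurable_component_singleton)
    have "AE x in PiM (verts H) (\<lambda>_. unit_measure). case (x u, x v) of (x, y) \<Rightarrow> W' x y = W x y"
      by (rule AE_distrD[OF m]) (simp only: distr_PiM_pair[OF e(2-4)] ae)
    then show ?thesis by (simp add: edge_val_def e(1))
  qed
  then have "AE x in PiM (verts H) (\<lambda>_. unit_measure). \<forall>e\<in>edges H. edge_val W' x e = edge_val W x e"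
    using fin by (subst AE_finite_all) auto
  then have "AE x in PiM (verts H) (\<lambda>_. unit_measure).
      (\<Prod>e\<in>edges H. edge_val W' x e) = (\<Prod>e\<in>edges H. edge_val W x e)"
    by (rule AE_mp) (auto intro!: AE_I2 prod.cong)
  then show ?thesis
    unfolding hom_density_def edge_val_def[of W, symmetric]
    by (intro integral_completion_AE hom_integrand_measurable W' H)
qed

text \<open>A Lebesgue measurable function agrees almost everywhere with a Borel function
  \<open>g\<close>. Averaging \<open>g\<close> with its transpose and clamping to the unit interval
  make symmetry and bounds hold everywhere, and change nothing where both \<open>(x, y)\<close> and
  \<open>(y, x)\<close> avoid the null set.\<close>

lemma graphon_Borel_version:
  assumes "graphon W"
  obtains W' where "(\<lambda>(x, y). W' x y) \<in> borel_measurable (unit_measure \<Otimes>\<^sub>M unit_measure)"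
    "\<And>x y. W' x y = W' y x" "\<And>x y. 0 \<le> W' x y \<and> W' x y \<le> 1"
    "AE (x, y) in unit_measure \<Otimes>\<^sub>M unit_measure. W' x y = W x y"
proof -
  interpret L: pair_sigma_finite "lborel :: real measure" "lborel :: real measure" ..
  interpret U: prob_space unit_measure by (rule prob_space_unit_measure)
  interpret UU: pair_prob_space unit_measure unit_measure ..
  let ?S = "{0..1 :: real} \<times> {0..1 :: real}"
  have S: "?S \<in> sets lborel" by (auto intro!: borel_closed closed_Times)
  have "(\<lambda>z. indicator ?S z *\<^sub>R (case z of (x, y) \<Rightarrow> W x y)) \<in> borel_measurable lebesgue"
    using assms S by (subst borel_measurable_restrict_space_iff[symmetric]) (auto simp: graphon_def)
  from completion_ex_borel_measurable_real[OF this] obtain g where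
    g: "g \<in> borel_measurable lborel" and
    g_eq: "AE z in lborel. indicator ?S z *\<^sub>R (case z of (x, y) \<Rightarrow> W x y) = g z"
    by auto
  define W' where "W' x y = max 0 (min 1 ((g (x, y) + g (y, x)) / 2))" for x y
  have g_pair: "g \<in> borel_measurable (borel \<Otimes>\<^sub>M borel)" using g by (simp add: borel_prod)
  have id: "(\<lambda>z. z) \<in> measurable (unit_measure \<Otimes>\<^sub>M unit_measure) (borel \<Otimes>\<^sub>M borel)"
  proof -
    have "(\<lambda>x. x) \<in> measurable unit_measure borel" by (intro measurable_restrict_space1) simp
    from measurable_Pair[OF measurable_compose[OF measurable_fst this] measurable_compose[OF measurable_snd this]]
    show ?thesis by simp
  qed
  have "(\<lambda>(x, y). W' x y) \<in> borel_measurable (borel \<Otimes>\<^sub>M borel)"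
    unfolding W'_def using g_pair by measurable
  from measurable_compose[OF id this]
  have W'_meas: "(\<lambda>(x, y). W' x y) \<in> borel_measurable (unit_measure \<Otimes>\<^sub>M unit_measure)" .
  obtain N where N: "N \<in> null_sets lborel"
    "{z \<in> space lborel. indicator ?S z *\<^sub>R (case z of (x, y) \<Rightarrow> W x y) \<noteq> g z} \<subseteq> N"
    by (rule AE_E[OF g_eq]) (auto simp: null_sets_def)
  have "AE z in lborel. z \<notin> N" using N(1) by (rule AE_not_in)
  then have "AE z in (lborel :: real measure) \<Otimes>\<^sub>M (lborel :: real measure). z \<notin> N"
    by (simp only: lborel_prod)
  \<comment> \<open>Iterated statements allow restriction to the unit interval one coordinate at a
    time.\<close>
  then have "AE x in lborel. AE y in lborel. (x, y) \<notin> N" by (rule lborel_pair.AE_pair)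
  then have "AE x in unit_measure. AE y in unit_measure. (x, y) \<notin> N"
    by (auto simp: AE_restrict_space_iff)
  moreover have "{z \<in> space (unit_measure \<Otimes>\<^sub>M unit_measure). z \<notin> N} \<in> sets (unit_measure \<Otimes>\<^sub>M unit_measure)"
  proof -
    have "- N \<in> sets borel" using N(1) by auto
    then have "- N \<in> sets (borel \<Otimes>\<^sub>M borel)" by (simp only: borel_prod)
    from measurable_sets[OF id this] show ?thesis
      by (rule arg_cong[where f = "\<lambda>S. S \<in> _", THEN iffD1, rotated]) auto
  qed
  ultimately have aeN: "AE z in unit_measure \<Otimes>\<^sub>M unit_measure. z \<notin> N"
    using UU.AE_pair_measure[of "\<lambda>z. z \<notin> N"] by simp
  note aeN
  \<comment> \<open>Swapping the coordinates preserves the product measure.\<close>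
  moreover have "AE z in unit_measure \<Otimes>\<^sub>M unit_measure. (case z of (x, y) \<Rightarrow> (y, x)) \<notin> N"
    by (rule AE_distrD[OF measurable_pair_swap']) (simp only: UU.distr_pair_swap[symmetric] aeN)
  moreover note AE_space[of "unit_measure \<Otimes>\<^sub>M unit_measure"]
  ultimately have "AE (x, y) in unit_measure \<Otimes>\<^sub>M unit_measure. W' x y = W x y"
  proof eventually_elim
    case (elim z)
    obtain x y where z: "z = (x, y)" by (cases z)
    then have xy: "x \<in> {0..1}" "y \<in> {0..1}"
      using elim(3) by (auto simp: space_pair_measure)
    have "W a b = g (a, b)" if "(a, b) \<notin> N" "a \<in> {0..1}" "b \<in> {0..1}" for a b
      using subsetD[OF N(2), of "(a, b)"] that by auto
    then have "W x y = g (x, y)" "W y x = g (y, x)"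
      using elim(1,2) xy by (simp_all add: z)
    moreover have "W x y = W y x" "0 \<le> W x y" "W x y \<le> 1"
      using assms xy by (auto simp: graphon_def)
    ultimately show ?case by (simp add: z W'_def)
  qed
  show thesis
    by (rule that[of W']) (fact | simp add: W'_def add.commute)+
qed

text \<open>Mixing with the constant graphon $1/2$ bounds a kernel and its complement away from $0$, so
  that all logarithms in the entropy argument are bounded.\<close>

definition mix :: "real \<Rightarrow> ('b \<Rightarrow> 'b \<Rightarrow> real) \<Rightarrow> 'b \<Rightarrow> 'b \<Rightarrow> real" where
  "mix t W x y = t / 2 + (1 - t) * W x y"

text \<open>Mixing commutes with exchanging the colours, so the mixed kernels are again
  complementary.\<close>

lemma mix_compl: "mix t (\<lambda>x y. 1 - W x y) = (\<lambda>x y. 1 - mix t W x y)"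
  by (simp add: mix_def fun_eq_iff algebra_simps add_divide_distrib[symmetric])

lemma mix_bounds:
  assumes "0 \<le> W x y" "W x y \<le> 1" "0 \<le> t" "t \<le> 1"
  shows "t / 2 \<le> mix t W x y" "mix t W x y \<le> 1"
proof -
  have "0 \<le> (1 - t) * W x y" "(1 - t) * W x y \<le> 1 - t"
    using assms by (auto intro: mult_left_le)
  with assms show "t / 2 \<le> mix t W x y" "mix t W x y \<le> 1"
    unfolding mix_def by linarith+
qed

lemma sym_kernel_mix:
  assumes "prob_space M" "(\<lambda>(x, y). W x y) \<in> borel_measurable (M \<Otimes>\<^sub>M M)" "\<And>x y. W x y = W y x"
    "\<And>x y. 0 \<le> W x y \<and> W x y \<le> 1" "0 < t" "t \<le> 1"
  shows "sym_kernel M (mix t W)"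
proof -
  interpret prob_space M by fact
  have "(\<lambda>z. mix t W (fst z) (snd z)) \<in> borel_measurable (M \<Otimes>\<^sub>M M)"
    using assms(2) unfolding mix_def case_prod_unfold by measurable
  moreover have "\<forall>z\<in>space (M \<Otimes>\<^sub>M M). t / 2 \<le> mix t W (fst z) (snd z) \<and> mix t W (fst z) (snd z) \<le> 1"
    using assms(4-6) by (intro ballI conjI mix_bounds) auto
  ultimately have "pos_bdd (M \<Otimes>\<^sub>M M) (\<lambda>(x, y). mix t W x y)"
    unfolding pos_bdd_def case_prod_unfold using assms(5)
    by (intro conjI exI[of _ "t / 2"] exI[of _ 1]) auto
  moreover have "mix t W x y = mix t W y x" for x y
    using assms(3)[of x y] by (simp add: mix_def)
  ultimately show ?thesis by unfold_locales
qed

text \<open>Dominated convergence with constant bound 1; it carries the inequality for positive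
  mixing weights over to the kernel itself.\<close>

lemma hom_mix_tendsto:
  assumes M: "prob_space M" and W: "(\<lambda>(x, y). W x y) \<in> borel_measurable (M \<Otimes>\<^sub>M M)"
    and W01: "\<And>x y. 0 \<le> W x y \<and> W x y \<le> 1" and H: "simple_graph H"
  shows "(\<lambda>n. \<integral>x. (\<Prod>e\<in>edges H. edge_val (mix (1 / real (Suc n)) W) x e) \<partial>PiM (verts H) (\<lambda>_. M))
    \<longlonglongrightarrow> (\<integral>x. (\<Prod>e\<in>edges H. edge_val W x e) \<partial>PiM (verts H) (\<lambda>_. M))"
proof (rule integral_dominated_convergence[where w = "\<lambda>_. 1"])
  interpret M: prob_space M by fact
  interpret P: prob_space "PiM (verts H) (\<lambda>_. M)" by (intro prob_space_PiM M)
  show "integrable (PiM (verts H) (\<lambda>_. M)) (\<lambda>_. 1 :: real)" by simp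
  show "(\<lambda>x. \<Prod>e\<in>edges H. edge_val W x e) \<in> borel_measurable (PiM (verts H) (\<lambda>_. M))"
    by (rule hom_integrand_measurable[OF W H])
  show "(\<lambda>x. \<Prod>e\<in>edges H. edge_val (mix (1 / real (Suc n)) W) x e) \<in> borel_measurable (PiM (verts H) (\<lambda>_. M))" for n
    using W unfolding mix_def case_prod_unfold
    by (intro hom_integrand_measurable H) (simp add: case_prod_unfold)
  have "0 \<le> edge_val (mix (1 / real (Suc n)) W) x e \<and> edge_val (mix (1 / real (Suc n)) W) x e \<le> 1" for n x e
  proof -
    obtain u v where e: "edge_ends e = (u, v)" by (cases "edge_ends e")
    have "0 \<le> 1 / real (Suc n) / 2" by simp
    moreover have "1 / real (Suc n) / 2 \<le> mix (1 / real (Suc n)) W (x u) (x v)"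
      "mix (1 / real (Suc n)) W (x u) (x v) \<le> 1"
      using W01[of "x u" "x v"] by (intro mix_bounds; simp)+
    ultimately show ?thesis unfolding edge_val_def e prod.case by linarith
  qed
  then have "\<bar>\<Prod>e\<in>edges H. edge_val (mix (1 / real (Suc n)) W) x e\<bar> \<le> 1" for n x
    by (subst abs_of_nonneg) (auto intro!: prod_nonneg prod_le_1)
  then show "AE x in PiM (verts H) (\<lambda>_. M). norm (\<Prod>e\<in>edges H. edge_val (mix (1 / real (Suc n)) W) x e) \<le> 1" for n
    by simp
  have "(\<lambda>n. edge_val (mix (1 / real (Suc n)) W) x e) \<longlonglongrightarrow> edge_val W x e" for x e
  proof -
    obtain u v where e: "edge_ends e = (u, v)" by (cases "edge_ends e")
    have "(\<lambda>n. 1 / real (Suc n) / 2 + (1 - 1 / real (Suc n)) * W (x u) (x v))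
        \<longlonglongrightarrow> 0 / 2 + (1 - 0) * W (x u) (x v)"
      using LIMSEQ_inverse_real_of_nat by (intro tendsto_intros) (simp_all add: inverse_eq_divide)
    then show ?thesis by (simp add: edge_val_def e mix_def)
  qed
  then show "AE x in PiM (verts H) (\<lambda>_. M).
      (\<lambda>n. \<Prod>e\<in>edges H. edge_val (mix (1 / real (Suc n)) W) x e) \<longlonglongrightarrow> (\<Prod>e\<in>edges H. edge_val W x e)"
    by (intro AE_I2 tendsto_prod) auto
qed

theorem theorem1:
  fixes T :: "'a graph" and k :: nat
  assumes "tree T" and "k \<in> {1, 2, 3, 4, 5}"
  shows "common (apex k T)"
  unfolding common_def
proof (intro allI impI)
  fix W assume "graphon W"
  then obtain W' where W': "(\<lambda>(x, y). W' x y) \<in> borel_measurable (unit_measure \<Otimes>\<^sub>M unit_measure)"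
    "\<And>x y. W' x y = W' y x" "\<And>x y. 0 \<le> W' x y \<and> W' x y \<le> 1"
    and ae: "AE (x, y) in unit_measure \<Otimes>\<^sub>M unit_measure. W' x y = W x y"
    by (rule graphon_Borel_version) blast
  have T: "leafwise (verts T) (edges T)" using assms(1) by (rule tree_leafwise)
  have H: "simple_graph (apex k T)"
    using assms(1) by (intro simple_graph_apex) (simp add: tree_def)
  define D where "D U = (\<integral>x. (\<Prod>e\<in>edges (apex k T). edge_val U x e)
    \<partial>PiM (verts (apex k T)) (\<lambda>_. unit_measure))" for U :: "real \<Rightarrow> real \<Rightarrow> real"
  \<comment> \<open>The complement of the Borel version, a Borel version of the second
    colour.\<close>
  define C where "C x y = 1 - W' x y" for x y
  have C: "(\<lambda>(x, y). C x y) \<in> borel_measurable (unit_measure \<Otimes>\<^sub>M unit_measure)"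
    "\<And>x y. C x y = C y x" "\<And>x y. 0 \<le> C x y \<and> C x y \<le> 1"
    using W' by (simp_all add: C_def case_prod_unfold)
  have "AE (x, y) in unit_measure \<Otimes>\<^sub>M unit_measure. C x y = 1 - W x y"
    using ae by (rule AE_mp) (auto simp: C_def)
  then have mono: "mono_density (apex k T) W = D W' + D C"
    unfolding mono_density_def D_def by (simp only: hom_density_AE_eq[OF H W'(1) ae] hom_density_AE_eq[OF H C(1)])
  have lim: "(\<lambda>n. D (mix (1 / real (Suc n)) W') + D (mix (1 / real (Suc n)) C)) \<longlonglongrightarrow> D W' + D C"
    unfolding D_def by (intro tendsto_add hom_mix_tendsto prob_space_unit_measure W' C H)
  have "2 * (1/2) ^ card (edges (apex k T)) \<le> D (mix t W') + D (mix t C)" if "0 < t" "t \<le> 1" for t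
  proof -
    have mixC: "mix t C = (\<lambda>x y. 1 - mix t W' x y)"
      unfolding C_def by (rule mix_compl)
    have "sym_kernel unit_measure (mix t W')" "sym_kernel unit_measure (mix t C)"
      using that W' C by (intro sym_kernel_mix prob_space_unit_measure; simp)+
    then interpret complementary_kernels unit_measure "mix t W'"
      unfolding mixC by (rule complementary_kernels.intro)
    show ?thesis
      using apex_mono_ge[OF T assms(2)] unfolding D_def mixC card_edges_apex[OF T] .
  qed
  \<comment> \<open>The bound is uniform in \<open>t\<close>, so it survives the limit along
    \<open>t = 1 / Suc n\<close>.\<close>
  then have "2 * (1/2) ^ card (edges (apex k T)) \<le> D W' + D C"
    by (intro LIMSEQ_le_const[OF lim]) auto
  also have "2 * (1/2) ^ card (edges (apex k T)) = 2 powr (1 - real (card (edges (apex k T))))"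
    by (simp add: powr_diff powr_realpow power_one_over)
  finally show "2 powr (1 - real (card (edges (apex k T)))) \<le> mono_density (apex k T) W"
    unfolding mono .
qed

end
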